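(* Let $p\in(0,1)$ and let $n\geq 0$ be an integer. Then, as $x\to 0^+$, $$e^{-\frac{\log p}{x}}m_p^{(n)}(x)=u_p^{(n)}(0)+\sum_{k=1}^n\sum_{l=1}^{k}\sum_{j=0}^{2k}\binom{n}{k}a_{l+k,k}\left(-\log p\right)^{l}\frac{u_p^{(n-k+j)}(0)}{j!\,x^{k+l-j}}+O(x),$$ and this can be written as $$e^{-\frac{\log p}{x}}m_p^{(n)}(x)=\sum_{k=0}^{2n}\frac{z_{k,n}}{x^k}+O(x)$$ with real numbers $z_{k,n}$ (depending on $p$), where $$z_{2n,n}=e^{-\gamma}(-\log p)^{n},$$ and, for $n\geq 1$, $$z_{2n-1,n}=e^{-\gamma}(-\log p)^{n-1}\left(-s_1\log p-n(n-1)\right).$$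
   Context: For $p\in(0,1)$ and $x>0$, $m_p(x)>0$ denotes the $p$-quantile of the gamma distribution with shape parameter $x$ and scale parameter $1$, i.e. the unique positive number with $\int_0^{m_p(x)}e^{-t}t^{x-1}\,dt=p\,\Gamma(x)$. (The function $m_p$ is $C^\infty$ on $(0,\infty)$.) Define $u_p(x)=e^{-\frac{\log p}{x}}m_p(x)$ for $x>0$, and $u_p^{(j)}(0)=\lim_{x\to0^+}u_p^{(j)}(x)$ for $j\geq 0$ (these limits exist in $\mathbb R$). The integers $a_{i,k}$ are, for $k\geq1$, the coefficients in $\frac{d^k}{dx^k}\left(e^{-1/x}\right)=p_k(1/x)e^{-1/x}$ ($x>0$), where $p_k(t)=\sum_{i=k+1}^{2k}a_{i,k}t^i$ is a polynomial. $\gamma$ is Euler's constant, and $$s_1=\int_0^{e^{-\gamma}}\frac{e^{-s}-1}{s}\log s\,ds+\int_{e^{-\gamma}}^{\infty}\frac{e^{-s}}{s}\log s\,ds .$$ *)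

theory Defs
  imports "HOL-Analysis.Analysis" "HOL-Library.Landau_Symbols"
begin

(* Meaningful for 0 < p < 1 and x > 0. *)
definition gamma_quantile :: "real \<Rightarrow> real \<Rightarrow> real" where
  "gamma_quantile p x =
     (THE m. m > 0 \<and> integral {0..m} (\<lambda>t. exp (- t) * t powr (x - 1)) = p * Gamma x)"

definition u :: "real \<Rightarrow> real \<Rightarrow> real" where
  "u p x = exp (- ln p / x) * gamma_quantile p x"

(* The value at 0 of the j-th derivative of u p, as a one-sided limit. *)
definition u_deriv0 :: "real \<Rightarrow> nat \<Rightarrow> real" where
  "u_deriv0 p j = Lim (at_right 0) ((deriv ^^ j) (u p))"

(* exp_inv_coeff i k is the coefficient of t^i in the polynomial p_k of degree 2k with
   (d/dx)^k exp (-1/x) = p_k (1/x) * exp (-1/x). It is meaningful for k \<ge> 1 only; outside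
   k+1..2k the coefficients are set to 0 to make the description unique. *)
definition exp_inv_coeff :: "nat \<Rightarrow> nat \<Rightarrow> int" where
  "exp_inv_coeff i k =
     (THE a :: nat \<Rightarrow> int.
        (\<forall>i. i \<notin> {k+1..2*k} \<longrightarrow> a i = 0) \<and>
        (\<forall>x>0. (deriv ^^ k) (\<lambda>x::real. exp (- 1 / x)) x =
               (\<Sum>i=k+1..2*k. of_int (a i) * (1 / x) ^ i) * exp (- 1 / x))) i"

definition s1 :: real where
  "s1 = integral {0..exp (- euler_mascheroni)} (\<lambda>s. (exp (- s) - 1) / s * ln s)
      + integral {exp (- euler_mascheroni)..} (\<lambda>s. exp (- s) / s * ln s)"

end

theory Submission
  imports Defs "HOL-Complex_Analysis.Complex_Analysis" "HOL-Real_Asymp.Real_Asymp"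
begin

text \<open>
  Write \<open>m\<close> for the \<open>p\<close>-quantile of the gamma distribution with shape \<open>x\<close>. Expanding the exponential in
  the incomplete gamma integral turns the defining equation of \<open>m\<close> into
  \<open>m powr x * (1 + x * g x m) = p * Gamma (1 + x)\<close>, where \<open>g x m\<close> is a power series in \<open>m\<close> without
  constant term. As \<open>m\<close> is roughly \<open>p powr (1 / x)\<close>, it is exponentially small near 0, so
  \<open>u p x = p powr (- 1 / x) * m\<close> differs from \<open>Gamma (1 + x) powr (1 / x)\<close> by an exponentially small
  amount only. The latter function is holomorphic near 0 and does not depend on \<open>p\<close>.

  To control derivatives as well, the quantile equation is solved by a holomorphic fixed point
  iteration in a complex sector around the positive axis
  (\<open>gamma_quantile_sector_extension\<close>). Cauchy's inequality then shows that each derivative of the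
  difference is still smaller than any power of \<open>x\<close> (\<open>higher_deriv_u_flat\<close>). Consequently each
  derivative of \<open>u p\<close> has a Taylor expansion at 0 whose coefficients are the derivatives at 0 of
  \<open>Gamma (1 + x) powr (1 / x)\<close> (\<open>u_deriv0_eq\<close>, \<open>higher_deriv_u_expansion\<close>).

  The first expansion of the theorem is the product rule for \<open>exp (ln p / x) * u p x\<close>
  (\<open>higher_deriv_gamma_quantile\<close>) with these Taylor polynomials inserted. The second one collects powers
  of \<open>x\<close>. The two coefficients of lowest order involve only the two top coefficients of the
  polynomials attached to \<open>exp (- 1 / x)\<close>, namely 1 and \<open>- n * (n - 1)\<close>, and the values of \<open>u p\<close>
  and its derivative at 0, namely \<open>exp (- euler_mascheroni)\<close> and \<open>exp (- euler_mascheroni) * s1\<close>. The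
  last value rests on \<open>s1 = Polygamma 1 1 / 2\<close> (\<open>s1_eq\<close>), an integration by parts that brings in the
  second derivative of the gamma function at 1.
\<close>

section \<open>Restricting iterated complex derivatives to the real line\<close>

text \<open>
  Derivatives of \<open>u p\<close> are estimated, and products expanded, for holomorphic functions, where iterated
  derivatives exist without further ado and Cauchy's inequality applies. This lemma carries the
  results back to the real line.
\<close>
lemma higher_deriv_of_real_restriction:
  fixes f :: "real \<Rightarrow> real" and F :: "complex \<Rightarrow> complex"
  assumes "F holomorphic_on A" "open A" "open X"
    and "\<And>x. x \<in> X \<Longrightarrow> of_real x \<in> A"
    and "\<And>x. x \<in> X \<Longrightarrow> F (of_real x) = of_real (f x)"
    and "x \<in> X"
  shows "(deriv ^^ j) F (of_real x) = of_real ((deriv ^^ j) f x)"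
  using assms(1,5,6)
proof (induction j arbitrary: f F x)
  case 0
  then show ?case by simp
next
  case (Suc j)
  have deriv_eq: "deriv F (of_real y) = of_real (deriv f y)" if y: "y \<in> X" for y
  proof -
    have "(F has_field_derivative deriv F (of_real y)) (at (of_real y))"
      using Suc.prems(1) assms(2,4) y holomorphic_derivI by blast
    then have "((\<lambda>t. F (of_real t)) has_vector_derivative deriv F (of_real y)) (at y)"
      by (rule has_vector_derivative_real_field)
    then have vd: "((\<lambda>t. complex_of_real (f t)) has_vector_derivative deriv F (of_real y)) (at y)"
      by (rule has_vector_derivative_transform_within_open[OF _ \<open>open X\<close> y])
         (use Suc.prems(2) in auto)
    \<comment> \<open>The difference quotients along the real axis are real, so their limit is real as well.\<close>
    have re: "(f has_field_derivative Re (deriv F (of_real y))) (at y)"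
      using bounded_linear.has_vector_derivative[OF bounded_linear_Re vd]
      by (simp add: has_real_derivative_iff_has_vector_derivative)
    have "((\<lambda>t. 0 :: real) has_vector_derivative Im (deriv F (of_real y))) (at y)"
      using bounded_linear.has_vector_derivative[OF bounded_linear_Im vd] by simp
    then have "Im (deriv F (of_real y)) = 0"
      using vector_derivative_unique_at has_vector_derivative_const by blast
    then show ?thesis
      using DERIV_imp_deriv[OF re] by (simp add: complex_eq_iff)
  qed
  have "(deriv ^^ j) (deriv F) (of_real x) = of_real ((deriv ^^ j) (deriv f) x)"
    using Suc.IH[of "deriv F" "deriv f" x] deriv_eq Suc.prems(1,3) assms(2) holomorphic_deriv by blast
  then show ?case
    by (simp add: funpow_swap1)
qed

section \<open>Derivatives of exp (- 1 / x)\<close>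

text \<open>
  Differentiating \<open>P (1 / x) * exp (- 1 / x)\<close> multiplies by \<open>1 / x\<^sup>2\<close> and replaces \<open>P\<close> by
  \<open>P - P'\<close>, which is the recursion used here.
\<close>
primrec exp_inv_poly :: "nat \<Rightarrow> real poly" where
  "exp_inv_poly 0 = 1"
| "exp_inv_poly (Suc k) = [:0, 0, 1:] * (exp_inv_poly k - pderiv (exp_inv_poly k))"

lemma coeff_exp_inv_poly_Suc:
  "coeff (exp_inv_poly (Suc k)) i =
     (if i < 2 then 0
      else coeff (exp_inv_poly k) (i - 2) - real (i - 1) * coeff (exp_inv_poly k) (i - 1))"
proof -
  have "i = 0 \<or> i = 1 \<or> (\<exists>j. i = Suc (Suc j))"
    by (metis One_nat_def not0_implies_Suc)
  then show ?thesis
    by (auto simp: coeff_pderiv coeff_pCons split: nat.splits)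
qed

lemma coeff_exp_inv_poly_Ints: "coeff (exp_inv_poly k) i \<in> \<int>"
proof (induction k arbitrary: i)
  case 0
  then show ?case by (auto simp: coeff_1)
next
  case (Suc k)
  then show ?case
    by (auto simp: coeff_exp_inv_poly_Suc simp del: exp_inv_poly.simps intro!: Ints_diff Ints_mult)
qed

lemma coeff_exp_inv_poly_eq_0:
  assumes "k \<ge> 1" "i \<notin> {k+1..2*k}"
  shows "coeff (exp_inv_poly k) i = 0"
  using assms
proof (induction k arbitrary: i rule: nat_induct_at_least)
  case base
  then show ?case
    by (auto simp: coeff_exp_inv_poly_Suc[of 0, simplified] coeff_1)
next
  case (Suc k)
  have "coeff (exp_inv_poly k) (i - 2) = 0 \<and> coeff (exp_inv_poly k) (i - 1) = 0" if "i \<ge> 2"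
    using Suc.prems Suc.hyps that by (auto intro!: Suc.IH)
  then show ?case
    by (simp add: coeff_exp_inv_poly_Suc del: exp_inv_poly.simps)
qed

lemma coeff_exp_inv_poly_top: "coeff (exp_inv_poly k) (2 * k) = 1"
proof (induction k)
  case 0
  then show ?case by simp
next
  case (Suc k)
  have "coeff (exp_inv_poly k) (2 * k + 1) = 0"
    by (cases "k = 0") (auto intro!: coeff_exp_inv_poly_eq_0 simp: coeff_1)
  with Suc show ?case
    by (simp add: coeff_exp_inv_poly_Suc del: exp_inv_poly.simps)
qed

text \<open>
  By the recursion the second coefficient drops by \<open>2 * k\<close> from each \<open>k\<close> to the next, since the
  leading coefficient is always 1; the sum of these even numbers is \<open>k * (k - 1)\<close>.
\<close>
lemma coeff_exp_inv_poly_below_top: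
  assumes "k \<ge> 1"
  shows "coeff (exp_inv_poly k) (2 * k - 1) = - (real k * (real k - 1))"
  using assms
proof (induction k rule: nat_induct_at_least)
  case base
  then show ?case by (simp add: coeff_exp_inv_poly_Suc[of 0, simplified])
next
  case (Suc k)
  have "coeff (exp_inv_poly (Suc k)) (2 * Suc k - 1)
        = coeff (exp_inv_poly k) (2 * k - 1) - real (2 * k) * coeff (exp_inv_poly k) (2 * k)"
    using Suc.hyps by (simp add: coeff_exp_inv_poly_Suc numeral_2_eq_2 del: exp_inv_poly.simps)
  then show ?case
    unfolding Suc.IH coeff_exp_inv_poly_top by (simp add: algebra_simps)
qed

lemma higher_deriv_exp_inv:
  fixes c x :: real
  assumes "x > 0" "c > 0"
  shows "(deriv ^^ k) (\<lambda>x. exp (- c / x)) x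
         = poly (exp_inv_poly k) (c / x) * exp (- c / x) / c ^ k"
  using \<open>x > 0\<close>
proof (induction k arbitrary: x)
  case 0
  then show ?case by simp
next
  case (Suc k)
  let ?P = "exp_inv_poly k"
  have "(deriv ^^ Suc k) (\<lambda>x. exp (- c / x)) x
        = deriv (\<lambda>x. poly ?P (c / x) * exp (- c / x) / c ^ k) x"
    using Suc by (auto intro!: deriv_cong_ev eventually_mono[OF eventually_nhds_in_open[of "{0<..}"]])
  also have "\<dots> = ((poly (pderiv ?P) (c / x) * (- c / x\<^sup>2)) * exp (- c / x)
                   + poly ?P (c / x) * (exp (- c / x) * (c / x\<^sup>2))) / c ^ k"
    by (rule DERIV_imp_deriv)
       (use Suc.prems \<open>c > 0\<close> in \<open>auto intro!: derivative_eq_intros DERIV_chain2[OF poly_DERIV]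
          simp: power2_eq_square field_simps\<close>)
  also have "\<dots> = poly (exp_inv_poly (Suc k)) (c / x) * exp (- c / x) / c ^ Suc k"
    using Suc.prems \<open>c > 0\<close> by (simp add: field_simps power2_eq_square)
  finally show ?case .
qed

lemma poly_exp_inv_poly:
  assumes "k \<ge> 1"
  shows "poly (exp_inv_poly k) t = (\<Sum>i=k+1..2*k. coeff (exp_inv_poly k) i * t ^ i)"
proof -
  have deg: "degree (exp_inv_poly k) \<le> 2 * k"
    by (rule degree_le) (use coeff_exp_inv_poly_eq_0[OF assms] in auto)
  have "poly (exp_inv_poly k) t = (\<Sum>i\<le>2*k. coeff (exp_inv_poly k) i * t ^ i)"
    unfolding poly_altdef by (rule sum.mono_neutral_left) (use deg in \<open>auto intro: coeff_eq_0\<close>)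
  also have "\<dots> = (\<Sum>i=k+1..2*k. coeff (exp_inv_poly k) i * t ^ i)"
    by (rule sum.mono_neutral_right) (use coeff_exp_inv_poly_eq_0[OF assms] in auto)
  finally show ?thesis .
qed

text \<open>
  The coefficients of \<open>exp_inv_poly k\<close> meet the defining condition of \<open>exp_inv_coeff\<close>, and no other
  family does: the difference of two such families is a polynomial vanishing on all positive reals.
\<close>
lemma of_int_exp_inv_coeff:
  assumes "k \<ge> 1"
  shows "of_int (exp_inv_coeff i k) = coeff (exp_inv_poly k) i"
proof -
  define Q where "Q = (\<lambda>a :: nat \<Rightarrow> int. (\<forall>i. i \<notin> {k+1..2*k} \<longrightarrow> a i = 0) \<and>
        (\<forall>x>0. (deriv ^^ k) (\<lambda>x::real. exp (- 1 / x)) x =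
               (\<Sum>i=k+1..2*k. of_int (a i) * (1 / x) ^ i) * exp (- 1 / x)))"
  define a where "a = (\<lambda>i. \<lfloor>coeff (exp_inv_poly k) i\<rfloor>)"
  have a: "of_int (a i) = coeff (exp_inv_poly k) i" for i
    using coeff_exp_inv_poly_Ints unfolding a_def by simp
  have Qa: "Q a"
    unfolding Q_def a using coeff_exp_inv_poly_eq_0[OF assms] higher_deriv_exp_inv[of _ 1 k]
    by (auto simp: a_def poly_exp_inv_poly[OF assms])
  have unique: "b = a" if "Q b" for b
  proof -
    define D where "D = (\<Sum>i=k+1..2*k. monom (of_int (b i) - of_int (a i) :: real) i)"
    have "poly D t = 0" if "t > 0" for t
      using Qa \<open>Q b\<close> that unfolding Q_def D_def
      by (auto simp: poly_sum poly_monom left_diff_distrib sum_subtractf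
               dest!: spec[of _ "1 / t"])
    then have "{0<..} \<subseteq> {t. poly D t = 0}" by auto
    then have "infinite {t. poly D t = 0}"
      using infinite_Ioi finite_subset by blast
    then have "D = 0" using poly_roots_finite by blast
    then have "coeff D i = 0" for i by simp
    moreover have "coeff D i = of_int (b i) - of_int (a i)" for i
      using \<open>Q b\<close> Qa unfolding D_def Q_def by (auto simp: coeff_sum if_distrib cong: if_cong)
    ultimately show "b = a" by (auto simp: fun_eq_iff)
  qed
  have "exp_inv_coeff i k = (THE a. Q a) i"
    unfolding exp_inv_coeff_def Q_def ..
  also have "(THE a. Q a) = a"
    using Qa unique by (rule the_equality)
  finally show ?thesis using a by simp
qed

section \<open>Fixed points depending holomorphically on a parameter\<close>

text \<open>
  A contraction with a holomorphic parameter has a holomorphic fixed point: the iterates starting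
  at 0 are holomorphic in the parameter and converge uniformly, at a geometric rate that is the same
  for all parameters. If the contraction preserves the reals, all iterates are real, and so is the
  limit.
\<close>
lemma holomorphic_fixed_point:
  fixes T :: "complex \<Rightarrow> complex \<Rightarrow> complex"
  assumes "open S"
    and maps: "\<And>z w. z \<in> S \<Longrightarrow> norm w \<le> 1 \<Longrightarrow> norm (T z w) \<le> 1"
    and contr: "\<And>z w w'. z \<in> S \<Longrightarrow> norm w \<le> 1 \<Longrightarrow> norm w' \<le> 1
                  \<Longrightarrow> norm (T z w - T z w') \<le> norm (w - w') / 2"
    and hol: "\<And>h. h holomorphic_on S \<Longrightarrow> (\<And>z. z \<in> S \<Longrightarrow> norm (h z) \<le> 1)
                  \<Longrightarrow> (\<lambda>z. T z (h z)) holomorphic_on S"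
  obtains w where "w holomorphic_on S"
    and "\<And>z. z \<in> S \<Longrightarrow> norm (w z) \<le> 1"
    and "\<And>z. z \<in> S \<Longrightarrow> T z (w z) = w z"
    and "\<And>z. z \<in> S \<Longrightarrow> (\<And>y. y \<in> \<real> \<Longrightarrow> norm y \<le> 1 \<Longrightarrow> T z y \<in> \<real>) \<Longrightarrow> w z \<in> \<real>"
proof -
  define it where "it = (\<lambda>n z. (T z ^^ n) 0)"
  have it_0: "it 0 = (\<lambda>z. 0)" and it_Suc: "it (Suc n) = (\<lambda>z. T z (it n z))" for n
    by (simp_all add: it_def)
  have it_bound: "norm (it n z) \<le> 1" if "z \<in> S" for n z
    by (induction n) (use maps[OF that] in \<open>simp_all add: it_0 it_Suc\<close>)
  have it_hol: "it n holomorphic_on S" for n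
    by (induction n) (simp_all add: it_0 it_Suc hol it_bound)
  have step: "norm (it (Suc n) z - it n z) \<le> (1 / 2) ^ n" if "z \<in> S" for n z
  proof (induction n)
    case 0
    then show ?case using it_bound[OF that, of 1] by (simp add: it_0)
  next
    case (Suc n)
    have "norm (it (Suc (Suc n)) z - it (Suc n) z) \<le> norm (it (Suc n) z - it n z) / 2"
      using contr[OF that it_bound[OF that, of "Suc n"] it_bound[OF that, of n]] unfolding it_Suc .
    with Suc show ?case by simp
  qed
  \<comment> \<open>The limit is written as a telescoping series, to which the Weierstrass M-test applies.\<close>
  define w where "w = (\<lambda>z. \<Sum>n. it (Suc n) z - it n z)"
  have "uniform_limit S (\<lambda>n z. \<Sum>i<n. it (Suc i) z - it i z) w sequentially"
    unfolding w_def by (rule Weierstrass_m_test[OF step]) (auto simp: summable_geometric)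
  moreover have tele: "(\<Sum>i<n. it (Suc i) z - it i z) = it n z" for n z
    using sum_lessThan_telescope[of "\<lambda>i. it i z" n] by (simp add: it_0)
  ultimately have unif: "uniform_limit S it w sequentially"
    by (simp only: tele)
  have lim: "(\<lambda>n. it n z) \<longlonglongrightarrow> w z" if "z \<in> S" for z
    using tendsto_uniform_limitI[OF unif that] .
  have w_bound: "norm (w z) \<le> 1" if "z \<in> S" for z
    by (rule Lim_norm_ubound[OF _ lim[OF that]]) (use it_bound[OF that] in auto)
  show ?thesis
  proof
    show "w holomorphic_on S"
    proof (rule holomorphic_uniform_sequence[OF \<open>open S\<close> it_hol])
      fix z assume "z \<in> S"
      then obtain d where "d > 0" "cball z d \<subseteq> S"
        using \<open>open S\<close> open_contains_cball by blast
      then show "\<exists>d>0. cball z d \<subseteq> S \<and> uniform_limit (cball z d) it w sequentially"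
        using uniform_limit_on_subset[OF unif] by blast
    qed
    show "norm (w z) \<le> 1" if "z \<in> S" for z
      using w_bound that .
    show "T z (w z) = w z" if "z \<in> S" for z
    proof -
      have "(\<lambda>n. it n z - w z) \<longlonglongrightarrow> 0"
        using lim[OF that] by (rule LIM_zero)
      then have "(\<lambda>n. T z (it n z) - T z (w z)) \<longlonglongrightarrow> 0"
        by (rule tendsto_0_le[where K = "1 / 2"])
           (use contr[OF that it_bound[OF that] w_bound[OF that]] in \<open>auto intro!: always_eventually\<close>)
      then have "(\<lambda>n. it (Suc n) z) \<longlonglongrightarrow> T z (w z)"
        unfolding it_Suc by (rule LIM_zero_cancel)
      moreover have "(\<lambda>n. it (Suc n) z) \<longlonglongrightarrow> w z"
        using lim[OF that] by (rule LIMSEQ_Suc)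
      ultimately show ?thesis
        using LIMSEQ_unique by blast
    qed
    show "w z \<in> \<real>" if z: "z \<in> S" and real: "\<And>y. y \<in> \<real> \<Longrightarrow> norm y \<le> 1 \<Longrightarrow> T z y \<in> \<real>" for z
    proof -
      have "it n z \<in> \<real>" for n
        by (induction n) (use real it_bound[OF z] in \<open>simp_all add: it_0 it_Suc\<close>)
      then show ?thesis
        by (rule closed_sequentially[OF closed_complex_Reals _ lim[OF z]])
    qed
  qed
qed

section \<open>The incomplete gamma function as a power series\<close>

text \<open>
  Expanding the exponential, the lower incomplete gamma function is
  \<open>m powr x * (1 / x + inc_gamma_corr x m)\<close>; the term \<open>1 / x\<close> is split off because it alone is
  singular at \<open>x = 0\<close>. The polymorphic definition gives the real function together with its
  holomorphic extension.
\<close>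
definition inc_gamma_corr :: "'a \<Rightarrow> 'a \<Rightarrow> 'a :: {real_normed_field, banach}" where
  "inc_gamma_corr z m = (\<Sum>k. (- m) ^ Suc k / (fact (Suc k) * (z + of_nat (Suc k))))"

text \<open>
  In the right half-plane the denominators \<open>z + k\<close> with \<open>k \<ge> 1\<close> have modulus at least 1, so that the
  series is dominated by the exponential series uniformly in \<open>z\<close>.
\<close>
lemma norm_inc_gamma_corr_term:
  fixes z m :: complex
  assumes "Re z > 0" "norm m \<le> 1"
  shows "norm ((- m) ^ Suc k / (fact (Suc k) * (z + of_nat (Suc k)))) \<le> norm m * (1 / fact (Suc k))"
proof -
  have "1 \<le> Re (z + of_nat (Suc k))"
    using assms(1) by simp
  also have "\<dots> \<le> norm (z + of_nat (Suc k))"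
    by (rule complex_Re_le_cmod)
  finally have "1 \<le> norm (z + of_nat (Suc k))" .
  moreover have "norm m ^ Suc k \<le> norm m"
    using assms(2) power_decreasing[of 1 "Suc k" "norm m"] by simp
  ultimately have "norm m ^ Suc k / (fact (Suc k) * norm (z + of_nat (Suc k))) \<le> norm m / (fact (Suc k) * 1)"
    by (intro frac_le mult_mono) auto
  then show ?thesis
    by (simp add: norm_divide norm_mult norm_power del: of_nat_Suc fact_Suc power_Suc)
qed

lemma sums_inverse_fact_Suc: "(\<lambda>k. 1 / fact (Suc k)) sums (exp 1 - 1 :: real)"
proof -
  have "(\<lambda>k. 1 / fact k) sums (exp 1 :: real)"
    using exp_converges[of "1::real"] by (simp add: divide_inverse)
  then show ?thesis
    using sums_Suc_iff[of "\<lambda>k. 1 / fact k :: real" "exp 1 - 1"] by simp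
qed

lemma inc_gamma_corr_holomorphic:
  fixes f h :: "complex \<Rightarrow> complex"
  assumes "f holomorphic_on A" "h holomorphic_on A" "open A"
    and pos: "\<And>t. t \<in> A \<Longrightarrow> Re (f t) > 0" and small: "\<And>t. t \<in> A \<Longrightarrow> norm (h t) \<le> 1"
  shows "(\<lambda>t. inc_gamma_corr (f t) (h t)) holomorphic_on A"
proof -
  have nz: "f t + of_nat (Suc k) \<noteq> 0" if "t \<in> A" for t k
  proof -
    have "Re (f t + of_nat (Suc k)) > 0"
      using pos[OF that] by (simp add: add_pos_pos)
    then show ?thesis by (metis less_irrefl zero_complex.sel(1))
  qed
  let ?a = "\<lambda>k t. (- h t) ^ Suc k / (fact (Suc k) * (f t + of_nat (Suc k)))"
  have "norm (?a k t) \<le> 1 / fact (Suc k)" if "t \<in> A" for k t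
    using norm_inc_gamma_corr_term[OF pos[OF that] small[OF that], of k]
          mult_right_mono[OF small[OF that], of "1 / fact (Suc k)"] by simp
  then have unif: "uniform_limit A (\<lambda>n t. \<Sum>k<n. ?a k t) (\<lambda>t. \<Sum>k. ?a k t) sequentially"
    by (rule Weierstrass_m_test) (use sums_summable[OF sums_inverse_fact_Suc] in auto)
  show ?thesis
    unfolding inc_gamma_corr_def
  proof (rule holomorphic_uniform_sequence[OF \<open>open A\<close>])
    show "(\<lambda>t. \<Sum>k<n. ?a k t) holomorphic_on A" for n
      by (intro holomorphic_intros assms) (use nz in auto)
    fix t assume "t \<in> A"
    then obtain d where "d > 0" "cball t d \<subseteq> A"
      using \<open>open A\<close> open_contains_cball by blast
    then show "\<exists>d>0. cball t d \<subseteq> A \<and>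
        uniform_limit (cball t d) (\<lambda>n t. \<Sum>k<n. ?a k t) (\<lambda>t. \<Sum>k. ?a k t) sequentially"
      using uniform_limit_on_subset[OF unif] by blast
  qed
qed

lemma norm_inc_gamma_corr_le:
  fixes z m :: complex
  assumes "Re z > 0" "norm m \<le> 1"
  shows "norm (inc_gamma_corr z m) \<le> 2 * norm m"
proof -
  have sums: "(\<lambda>k. norm m * (1 / fact (Suc k))) sums (norm m * (exp 1 - 1))"
    by (rule sums_mult[OF sums_inverse_fact_Suc])
  have "norm (inc_gamma_corr z m) \<le> (\<Sum>k. norm m * (1 / fact (Suc k)))"
    unfolding inc_gamma_corr_def
    by (rule norm_suminf_le[OF norm_inc_gamma_corr_term[OF assms] sums_summable[OF sums]])
  also have "\<dots> = norm m * (exp 1 - 1)"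
    using sums sums_unique by metis
  also have "\<dots> \<le> norm m * 2"
    using exp_le by (intro mult_left_mono) auto
  finally show ?thesis by simp
qed

lemma summable_inc_gamma_coeff:
  fixes x y :: real
  assumes "x > 0"
  shows "summable (\<lambda>k. (- 1) ^ k / (fact k * (x + of_nat k)) * y ^ k)"
proof (rule summable_comparison_test')
  show "summable (\<lambda>k. (1 / x) * (inverse (fact k) * \<bar>y\<bar> ^ k))"
    by (intro summable_mult summable_exp)
  show "norm ((- 1) ^ k / (fact k * (x + of_nat k)) * y ^ k) \<le> (1 / x) * (inverse (fact k) * \<bar>y\<bar> ^ k)" for k
  proof -
    have "norm ((- 1) ^ k / (fact k * (x + of_nat k)) * y ^ k) = \<bar>y\<bar> ^ k / (fact k * (x + of_nat k))"
      using assms by (simp add: abs_mult power_abs)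
    also have "\<dots> \<le> \<bar>y\<bar> ^ k / (fact k * x)"
      using assms by (intro divide_left_mono mult_left_mono) auto
    finally show ?thesis by (simp add: field_simps)
  qed
qed

lemma inc_gamma_term_Suc:
  "(- 1) ^ Suc k / (fact (Suc k) * (x + of_nat (Suc k))) * m ^ Suc k
     = (- m) ^ Suc k / (fact (Suc k) * (x + of_nat (Suc k)))" for x m :: real
  by (simp only: power_minus[of m] times_divide_eq_left)

lemma inc_gamma_series_split:
  fixes x m :: real
  assumes "x > 0"
  shows "(\<Sum>k. (- 1) ^ k / (fact k * (x + of_nat k)) * m ^ k) = 1 / x + inc_gamma_corr x m"
  using suminf_split_head[OF summable_inc_gamma_coeff[OF assms, of m]]
  unfolding inc_gamma_corr_def inc_gamma_term_Suc by simp

lemma inc_gamma_corr_of_real: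
  fixes x m :: real
  assumes "x > 0"
  shows "inc_gamma_corr (of_real x) (of_real m) = (of_real (inc_gamma_corr x m) :: complex)"
proof -
  have "summable (\<lambda>k. (- m) ^ Suc k / (fact (Suc k) * (x + of_nat (Suc k))))"
    using summable_inc_gamma_coeff[OF assms, of m] unfolding inc_gamma_term_Suc[where m = m, symmetric]
    by (subst summable_Suc_iff)
  then show ?thesis
    unfolding inc_gamma_corr_def
    by (subst suminf_of_real) (simp_all del: of_nat_Suc fact_Suc power_Suc)
qed

text \<open>
  Term by term, the operator \<open>x + m * d/dm\<close> cancels the denominators \<open>x + k\<close> and turns the series into
  that of \<open>exp (- m)\<close>.
\<close>
lemma inc_gamma_deriv:
  fixes x m :: real
  assumes "x > 0" "m > 0"
  shows "((\<lambda>m. m powr x * (1 / x + inc_gamma_corr x m)) has_real_derivative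
            exp (- m) * m powr (x - 1)) (at m)"
proof -
  let ?c = "\<lambda>k. (- 1) ^ k / (fact k * (x + of_nat k)) :: real"
  let ?F = "\<lambda>m. \<Sum>k. ?c k * m ^ k"
  note summ = summable_inc_gamma_coeff[OF \<open>x > 0\<close>]
  define D where "D = (\<Sum>k. diffs ?c k * m ^ k)"
  have dF: "(?F has_real_derivative D) (at m)"
    unfolding D_def by (rule termdiffs_strong_converges_everywhere) (rule summ)
  have sdiffs: "summable (\<lambda>k. diffs ?c k * m ^ k)"
    by (rule termdiff_converges_all) (rule summ)
  have "m * D = (\<Sum>k. of_nat k * ?c k * m ^ k)" "summable (\<lambda>k. of_nat k * ?c k * m ^ k)"
  proof -
    have "(\<lambda>k. of_nat (Suc k) * ?c (Suc k) * m ^ Suc k) sums (m * D)"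
      unfolding D_def using sums_mult[OF summable_sums[OF sdiffs], of m]
      by (simp add: diffs_def mult_ac)
    then have s: "(\<lambda>k. of_nat k * ?c k * m ^ k) sums (m * D)"
      by (subst (asm) sums_Suc_iff) simp
    then show "m * D = (\<Sum>k. of_nat k * ?c k * m ^ k)" "summable (\<lambda>k. of_nat k * ?c k * m ^ k)"
      by (auto simp: sums_iff)
  qed
  then have "x * ?F m + m * D = (\<Sum>k. x * (?c k * m ^ k) + of_nat k * ?c k * m ^ k)"
    using suminf_add[OF summable_mult[OF summ[of m], of x]] suminf_mult[OF summ[of m], of x] by simp
  also have "(\<lambda>k. x * (?c k * m ^ k) + of_nat k * ?c k * m ^ k) = (\<lambda>k. (- m) ^ k /\<^sub>R fact k)"
  proof
    fix k
    have "x + real k \<noteq> 0" using \<open>x > 0\<close> by simp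
    then have "(x + real k) * ?c k = (- 1) ^ k / fact k"
      by simp
    moreover have "x * (?c k * m ^ k) + of_nat k * ?c k * m ^ k = (x + real k) * ?c k * m ^ k"
      by (simp only: distrib_right mult.assoc)
    ultimately show "x * (?c k * m ^ k) + of_nat k * ?c k * m ^ k = (- m) ^ k /\<^sub>R fact k"
      by (simp only: power_minus[of m] real_scaleR_def divide_inverse mult_ac)
  qed
  also have "(\<Sum>k. (- m) ^ k /\<^sub>R fact k) = exp (- m)"
    by (simp add: exp_def)
  finally have ode: "x * ?F m + m * D = exp (- m)" .
  have "((\<lambda>m. m powr x * ?F m) has_real_derivative
           x * m powr (x - 1) * ?F m + m powr x * D) (at m)"
    using DERIV_mult[OF has_real_derivative_powr[OF \<open>m > 0\<close>, of x] dF] by (simp only: mult_ac add_ac)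
  also have "m powr x = m powr (x - 1) * m"
    using assms by (simp add: powr_diff)
  also have "x * m powr (x - 1) * ?F m + m powr (x - 1) * m * D = m powr (x - 1) * (x * ?F m + m * D)"
    by (simp add: algebra_simps)
  finally show ?thesis
    unfolding ode unfolding inc_gamma_series_split[OF \<open>x > 0\<close>] by (simp only: mult.commute)
qed

lemma has_integral_inc_gamma:
  fixes x m :: real
  assumes "x > 0" "m \<ge> 0"
  shows "((\<lambda>t. exp (- t) * t powr (x - 1)) has_integral m powr x * (1 / x + inc_gamma_corr x m)) {0..m}"
proof -
  have "isCont (\<lambda>m. 1 / x + inc_gamma_corr x m) t" for t
    unfolding inc_gamma_series_split[OF \<open>x > 0\<close>, symmetric]
    by (rule DERIV_isCont[OF termdiffs_strong_converges_everywhere]) (rule summable_inc_gamma_coeff[OF \<open>x > 0\<close>])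
  then have "continuous_on {0..m} (\<lambda>m. m powr x * (1 / x + inc_gamma_corr x m))"
    using \<open>x > 0\<close> by (intro continuous_on_mult continuous_on_powr' continuous_intros continuous_at_imp_continuous_on) auto
  then have "((\<lambda>t. exp (- t) * t powr (x - 1)) has_integral
          m powr x * (1 / x + inc_gamma_corr x m) - 0 powr x * (1 / x + inc_gamma_corr x 0)) {0..m}"
    by (intro fundamental_theorem_of_calculus_interior assms)
       (use inc_gamma_deriv[OF \<open>x > 0\<close>] in \<open>auto simp: has_real_derivative_iff_has_vector_derivative[symmetric]\<close>)
  then show ?thesis using assms by simp
qed

text \<open>
  The incomplete gamma function is strictly increasing in its upper limit, so any positive
  solution of the quantile equation is the quantile.
\<close>
lemma gamma_quantile_eqI:
  assumes "x > 0" "m > 0" and eq: "m powr x * (1 / x + inc_gamma_corr x m) = p * Gamma x"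
  shows "gamma_quantile p x = m"
  unfolding gamma_quantile_def
proof (rule the_equality)
  let ?A = "\<lambda>m. m powr x * (1 / x + inc_gamma_corr x m)"
  have int: "integral {0..m} (\<lambda>t. exp (- t) * t powr (x - 1)) = ?A m" if "m > 0" for m
    using has_integral_inc_gamma[of x m] \<open>x > 0\<close> that integral_unique by auto
  show "m > 0 \<and> integral {0..m} (\<lambda>t. exp (- t) * t powr (x - 1)) = p * Gamma x"
    using assms int by simp
  have mono: "?A a < ?A b" if "0 < a" "a < b" for a b
  proof (rule DERIV_pos_imp_increasing[OF \<open>a < b\<close>])
    fix t assume "a \<le> t" "t \<le> b"
    then show "\<exists>y. DERIV ?A t :> y \<and> 0 < y"
      using inc_gamma_deriv[OF \<open>x > 0\<close>, of t] that by (intro exI[of _ "exp (- t) * t powr (x - 1)"]) auto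
  qed
  fix m' assume "m' > 0 \<and> integral {0..m'} (\<lambda>t. exp (- t) * t powr (x - 1)) = p * Gamma x"
  then have "m' > 0" "?A m' = ?A m"
    using int eq by auto
  then show "m' = m"
    using mono[of m m'] mono[of m' m] \<open>m > 0\<close> by force
qed

section \<open>The function Gamma (1 + z) powr (1 / z) near 0\<close>

text \<open>
  The limiting profile of \<open>u p\<close> near 0 is the function \<open>Gamma (1 + z) powr (1 / z)\<close>. Its logarithm has a
  removable singularity at 0 because \<open>ln_Gamma 1 = 0\<close>; the value there is the derivative of \<open>ln_Gamma\<close>
  at 1, which is \<open>- euler_mascheroni\<close>.
\<close>
definition log_gamma_slope :: "complex \<Rightarrow> complex" where
  "log_gamma_slope z = (if z = 0 then - euler_mascheroni else ln_Gamma (1 + z) / z)"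

definition gamma_root :: "complex \<Rightarrow> complex" where
  "gamma_root z = exp (log_gamma_slope z)"

lemma one_plus_ball_notin_nonpos_Reals:
  "norm z < 1 \<Longrightarrow> 1 + z \<notin> \<real>\<^sub>\<le>\<^sub>0" for z :: complex
  using abs_Re_le_cmod[of z] by (auto simp: complex_nonpos_Reals_iff)

lemma has_field_derivative_ln_Gamma_one_plus:
  fixes z :: complex
  assumes "norm z < 1"
  shows "((\<lambda>z. ln_Gamma (1 + z)) has_field_derivative Digamma (1 + z)) (at z)"
  using one_plus_ball_notin_nonpos_Reals[OF assms]
  by (auto intro!: derivative_eq_intros)

lemma log_gamma_slope_holomorphic: "log_gamma_slope holomorphic_on ball 0 1"
proof (rule pole_theorem_open_0[where a = 0 and g = "\<lambda>z. ln_Gamma (1 + z)"])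
  show "(\<lambda>z. ln_Gamma (1 + z)) holomorphic_on ball (0 :: complex) 1"
    using has_field_derivative_ln_Gamma_one_plus
    by (intro holomorphic_onI) (auto simp: field_differentiable_def intro: has_field_derivative_at_within)
  show "log_gamma_slope 0 = deriv (\<lambda>z. ln_Gamma (1 + z)) 0"
    using DERIV_imp_deriv[OF has_field_derivative_ln_Gamma_one_plus[of 0]]
    by (simp add: log_gamma_slope_def)
qed (use ln_Gamma_complex_conv_fact[of 1] in \<open>auto simp: log_gamma_slope_def\<close>)

lemma gamma_root_holomorphic: "gamma_root holomorphic_on ball 0 1"
  unfolding gamma_root_def[abs_def] by (intro holomorphic_intros log_gamma_slope_holomorphic)

lemma gamma_root_of_real:
  assumes "0 < x"
  shows "gamma_root (of_real x) = of_real (exp (ln_Gamma (1 + x) / x))"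
proof -
  have "ln_Gamma (1 + complex_of_real x) = of_real (ln_Gamma (1 + x))"
    using ln_Gamma_complex_of_real[of "1 + x"] assms by simp
  then show ?thesis
    using assms by (simp add: gamma_root_def log_gamma_slope_def exp_of_real[symmetric])
qed

section \<open>Holomorphic extension of the quantile to a sector\<close>

text \<open>
  On this sector \<open>Re (1 / z)\<close> is comparable with \<open>1 / \<bar>z\<bar>\<close>, so that \<open>p powr (1 / z)\<close> still decays
  exponentially at 0; at the same time the sector contains around each small \<open>x > 0\<close> a disc with radius
  proportional to \<open>x\<close>.
\<close>
definition sector :: "real \<Rightarrow> complex set" where
  "sector r = {z. 0 < Re z \<and> Re z < r \<and> \<bar>Im z\<bar> < Re z}"

lemma open_sector: "open (sector r)"
  unfolding sector_def by (intro open_Collect_conj open_Collect_less continuous_intros)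

lemma sector_norm_less: "z \<in> sector r \<Longrightarrow> norm z < 2 * r"
  using cmod_le[of z] by (auto simp: sector_def)

lemma cball_subset_sector:
  assumes "0 < x" "3 * x < 2 * r"
  shows "cball (of_real x) (x / 3) \<subseteq> sector r"
proof
  fix z assume "z \<in> cball (complex_of_real x) (x / 3)"
  then have "norm (z - of_real x) \<le> x / 3"
    by (simp add: dist_norm norm_minus_commute)
  then have "\<bar>Re z - x\<bar> \<le> x / 3" "\<bar>Im z\<bar> \<le> x / 3"
    using abs_Re_le_cmod[of "z - of_real x"] abs_Im_le_cmod[of "z - of_real x"] by auto
  then show "z \<in> sector r"
    using assms unfolding sector_def mem_Collect_eq by (intro conjI; linarith)
qed

lemma norm_exp_ln_over:
  assumes "z \<in> sector r" "a \<le> 0"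
  shows "norm (exp (of_real a / z)) \<le> exp (a / (2 * Re z))"
proof -
  have z: "0 < Re z" "\<bar>Im z\<bar> \<le> \<bar>Re z\<bar>" "z \<noteq> 0"
    using assms(1) by (auto simp: sector_def)
  have "(Im z)\<^sup>2 \<le> (Re z)\<^sup>2"
    using z(2) by (simp add: abs_le_square_iff)
  then have "(Re z)\<^sup>2 + (Im z)\<^sup>2 \<le> 2 * Re z * Re z"
    by (simp add: power2_eq_square)
  then have "Re z / (2 * Re z * Re z) \<le> Re z / ((Re z)\<^sup>2 + (Im z)\<^sup>2)"
    using z by (intro divide_left_mono mult_pos_pos) (auto simp: sum_power2_gt_zero_iff)
  then have "1 / (2 * Re z) \<le> Re z / ((Re z)\<^sup>2 + (Im z)\<^sup>2)"
    using z by simp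
  from mult_left_mono_neg[OF this \<open>a \<le> 0\<close>]
  have "Re (of_real a / z) \<le> a / (2 * Re z)"
    by (simp add: Re_divide)
  then show ?thesis
    by simp
qed

text \<open>
  With \<open>m = exp (ln p / z) * gamma_root z * exp w\<close> the quantile equation
  \<open>m powr z * (1 + z * inc_gamma_corr z m) = p * Gamma (1 + z)\<close> becomes the fixed point equation
  \<open>w = - Ln (1 + z * inc_gamma_corr z m) / z\<close>. Its right-hand side is of the size of \<open>m\<close>, hence
  exponentially small near 0. The bound holds for all \<open>w\<close> in a disc larger than the unit disc, so by
  Cauchy's inequality the derivative in \<open>w\<close> is small too, and the right-hand side is a contraction.
  The fixed point \<open>w\<close> inherits the exponential bound, and \<open>gamma_root z * exp (w z)\<close> extends \<open>u p\<close>.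
\<close>
lemma gamma_quantile_sector_extension:
  assumes "0 < p" "p < 1"
  obtains r C U where "0 < r" "r \<le> 1 / 4" "U holomorphic_on sector r"
    "\<And>x. 0 < x \<Longrightarrow> x < r \<Longrightarrow> U (of_real x) = of_real (u p x)"
    "\<And>z. z \<in> sector r \<Longrightarrow> norm (U z - gamma_root z) \<le> C * exp (ln p / (2 * Re z))"
proof -
  have lnp: "ln p < 0" using assms by simp
  have "continuous_on (cball 0 (1 / 2)) gamma_root"
    by (rule holomorphic_on_imp_continuous_on[OF holomorphic_on_subset[OF gamma_root_holomorphic]]) auto
  then have "bounded (gamma_root ` cball 0 (1 / 2))"
    by (intro compact_imp_bounded compact_continuous_image) auto
  then obtain B where "B > 0" and B: "\<And>z. norm z \<le> 1 / 2 \<Longrightarrow> norm (gamma_root z) \<le> B"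
    unfolding bounded_pos by auto
  \<comment> \<open>The sector is taken so small that the bound \<open>\<epsilon>\<close> on \<open>m\<close> defined below is at most 1/16.\<close>
  have "((\<lambda>r. 16 * B * exp 3 * exp (ln p / (2 * r))) \<longlongrightarrow> 0) (at_right 0)"
    using lnp by real_asymp
  then have "\<forall>\<^sub>F r in at_right 0. 16 * B * exp 3 * exp (ln p / (2 * r)) < 1"
    by (rule order_tendstoD) simp
  moreover have "\<forall>\<^sub>F r in at_right 0. 0 < r \<and> r \<le> (1 / 4 :: real)"
    unfolding eventually_at_right_field by (intro exI[of _ "1 / 4"]) auto
  ultimately obtain r where r: "0 < r" "r \<le> 1 / 4" "16 * B * exp 3 * exp (ln p / (2 * r)) < 1"
    using eventually_happens'[OF _ eventually_conj] trivial_limit_at_right_real by blast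
  define \<epsilon> where "\<epsilon> = (\<lambda>z. B * exp 3 * exp (ln p / (2 * Re z)))"
  have \<epsilon>_small: "\<epsilon> z \<le> 1 / 16" if "z \<in> sector r" for z
  proof -
    have "ln p / (2 * Re z) \<le> ln p / (2 * r)"
      using that lnp r(1) by (intro divide_left_mono_neg) (auto simp: sector_def)
    then have "\<epsilon> z \<le> B * exp 3 * exp (ln p / (2 * r))"
      unfolding \<epsilon>_def using \<open>B > 0\<close> by (intro mult_left_mono) auto
    then show ?thesis using r(3) by linarith
  qed
  have norm_z: "norm z < 1 / 2" if "z \<in> sector r" for z
    using sector_norm_less[OF that] r(2) by linarith
  have z_nz: "z \<noteq> 0" if "z \<in> sector r" for z
    using that by (auto simp: sector_def)
  have Re_pos: "Re z > 0" if "z \<in> sector r" for z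
    using that by (auto simp: sector_def)

  define m where "m = (\<lambda>z w. exp (of_real (ln p) / z) * gamma_root z * exp w)"
  define y where "y = (\<lambda>z w. z * inc_gamma_corr z (m z w))"
  define T where "T = (\<lambda>z w. - Ln (1 + y z w) / z)"
  have m_le: "norm (m z w) \<le> \<epsilon> z" if "z \<in> sector r" "norm w \<le> 3" for z w
  proof -
    have "norm (exp w) \<le> exp 3"
      using norm_exp[of w] that(2) by (meson exp_le_cancel_iff order_trans)
    then have "norm (m z w) \<le> exp (ln p / (2 * Re z)) * B * exp 3"
      unfolding m_def norm_mult using norm_exp_ln_over[OF that(1), of "ln p"] lnp B[of z] norm_z[OF that(1)] \<open>B > 0\<close>
      by (intro mult_mono) auto
    then show ?thesis by (simp add: \<epsilon>_def mult_ac)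
  qed
  have y_le: "norm (y z w) \<le> norm z * (2 * \<epsilon> z)" if "z \<in> sector r" "norm w \<le> 3" for z w
    unfolding y_def norm_mult
    using norm_inc_gamma_corr_le[of z "m z w"] Re_pos[OF that(1)] m_le[OF that] \<epsilon>_small[OF that(1)]
    by (intro mult_left_mono) auto
  have y_small: "norm (y z w) \<le> 1 / 8" if "z \<in> sector r" "norm w \<le> 3" for z w
  proof -
    have "norm z * (2 * \<epsilon> z) \<le> 1 * (2 * (1 / 16))"
      using norm_z[OF that(1)] \<epsilon>_small[OF that(1)] \<open>B > 0\<close>
      by (intro mult_mono) (auto simp: \<epsilon>_def)
    then show ?thesis using y_le[OF that] by linarith
  qed
  have T_le: "norm (T z w) \<le> 4 * \<epsilon> z" if "z \<in> sector r" "norm w \<le> 3" for z w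
  proof -
    have "norm (Ln (1 + y z w)) \<le> 2 * norm (y z w)"
      using y_small[OF that] by (intro norm_Ln_le) auto
    also have "\<dots> \<le> norm z * (4 * \<epsilon> z)"
      using y_le[OF that] by simp
    finally show ?thesis
      using z_nz[OF that(1)] by (simp add: T_def norm_divide field_simps)
  qed
  \<comment> \<open>This joint form yields both the holomorphy in \<open>w\<close> for fixed \<open>z\<close> and the holomorphy of the iterates in \<open>z\<close>.\<close>
  have T_hol: "(\<lambda>t. T (f t) (h t)) holomorphic_on A"
    if f: "f holomorphic_on A" and h: "h holomorphic_on A" and A: "open A"
      and f_in: "\<And>t. t \<in> A \<Longrightarrow> f t \<in> sector r" and h_le: "\<And>t. t \<in> A \<Longrightarrow> norm (h t) \<le> 3" for f h A
  proof -
    have "(\<lambda>t. gamma_root (f t)) holomorphic_on A"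
      by (rule holomorphic_on_compose_gen[OF f gamma_root_holomorphic, unfolded o_def])
         (use norm_z f_in in force)
    then have m: "(\<lambda>t. m (f t) (h t)) holomorphic_on A"
      unfolding m_def using f h f_in z_nz by (intro holomorphic_intros) auto
    have "(\<lambda>t. inc_gamma_corr (f t) (m (f t) (h t))) holomorphic_on A"
      by (rule inc_gamma_corr_holomorphic[OF f m A])
         (use Re_pos m_le \<epsilon>_small f_in h_le in \<open>force+\<close>)
    then have "(\<lambda>t. y (f t) (h t)) holomorphic_on A"
      unfolding y_def by (intro holomorphic_intros f)
    moreover have "1 + y (f t) (h t) \<notin> \<real>\<^sub>\<le>\<^sub>0" if "t \<in> A" for t
      using y_small[of "f t" "h t"] f_in[OF that] h_le[OF that] by (intro one_plus_ball_notin_nonpos_Reals) force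
    ultimately show ?thesis
      unfolding T_def using f f_in z_nz by (intro holomorphic_intros) auto
  qed
  have T_contr: "norm (T z w - T z w') \<le> norm (w - w') / 2"
    if z: "z \<in> sector r" and w: "norm w \<le> 1" "norm w' \<le> 1" for z w w'
  proof -
    have hol: "T z holomorphic_on ball 0 3"
      using T_hol[of "\<lambda>_. z" "ball 0 3" "\<lambda>t. t"] z by auto
    have "norm (T z w - T z w') \<le> 1 / 4 * norm (w - w')"
    proof (rule field_differentiable_bound[of "cball 0 1"])
      fix t :: complex assume t: "t \<in> cball 0 1"
      then show "(T z has_field_derivative deriv (T z) t) (at t within cball 0 1)"
        using holomorphic_derivI[OF hol, of t] by (auto intro: has_field_derivative_at_within)
      have sub: "cball t 1 \<subseteq> ball 0 3"
      proof
        fix s assume "s \<in> cball t 1"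
        then show "s \<in> ball 0 3"
          using t norm_triangle_ineq[of t "s - t"] by (simp add: dist_norm norm_minus_commute)
      qed
      have "norm ((deriv ^^ 1) (T z) t) \<le> fact 1 * (1 / 4) / 1 ^ 1"
      proof (rule Cauchy_inequality)
        show "T z holomorphic_on ball t 1" "continuous_on (cball t 1) (T z)"
          using hol sub holomorphic_on_subset holomorphic_on_imp_continuous_on
          by (meson ball_subset_cball order_trans)+
        fix s assume "norm (t - s) = 1"
        then have "norm s \<le> 3"
          using sub by (auto simp: subset_iff dist_norm less_imp_le)
        then show "norm (T z s) \<le> 1 / 4"
          using T_le[OF z, of s] \<epsilon>_small[OF z] by linarith
      qed simp
      then show "norm (deriv (T z) t) \<le> 1 / 4" by simp
    qed (use w in auto)
    also have "\<dots> \<le> norm (w - w') / 2" by simp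
    finally show ?thesis .
  qed
  obtain w where w: "w holomorphic_on sector r"
      "\<And>z. z \<in> sector r \<Longrightarrow> norm (w z) \<le> 1"
      "\<And>z. z \<in> sector r \<Longrightarrow> T z (w z) = w z"
      "\<And>z. z \<in> sector r \<Longrightarrow> (\<And>t. t \<in> \<real> \<Longrightarrow> norm t \<le> 1 \<Longrightarrow> T z t \<in> \<real>) \<Longrightarrow> w z \<in> \<real>"
  proof (rule holomorphic_fixed_point[OF open_sector[of r], of T])
    show "norm (T z w) \<le> 1" if "z \<in> sector r" "norm w \<le> 1" for z w
      using T_le[OF that(1), of w] \<epsilon>_small[OF that(1)] that(2) by linarith
    show "(\<lambda>z. T z (h z)) holomorphic_on sector r"
      if "h holomorphic_on sector r" "\<And>z. z \<in> sector r \<Longrightarrow> norm (h z) \<le> 1" for h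
      using T_hol[of "\<lambda>z. z" "sector r" h] that open_sector by force
  qed (use T_contr in auto)
  define U where "U = (\<lambda>z. gamma_root z * exp (w z))"
  show ?thesis
  proof
    show "0 < r" "r \<le> 1 / 4" by fact+
    show "U holomorphic_on sector r"
      unfolding U_def using norm_z
      by (intro holomorphic_intros w(1) holomorphic_on_subset[OF gamma_root_holomorphic]) force
    show "norm (U z - gamma_root z) \<le> 6 * B\<^sup>2 * exp 3 * exp (ln p / (2 * Re z))"
      if z: "z \<in> sector r" for z
    proof -
      have "norm (w z) \<le> 4 * \<epsilon> z"
        using T_le[OF z, of "w z"] w(2,3)[OF z] by simp
      moreover from this have "norm (exp (w z) - 1) \<le> 3 / 2 * norm (w z)"
        using \<epsilon>_small[OF z] by (intro norm_exp_bounds) linarith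
      ultimately have "norm (exp (w z) - 1) \<le> 6 * \<epsilon> z" by linarith
      then have "norm (gamma_root z) * norm (exp (w z) - 1) \<le> B * (6 * \<epsilon> z)"
        using B[of z] norm_z[OF z] \<open>B > 0\<close> by (intro mult_mono) auto
      also have "norm (gamma_root z) * norm (exp (w z) - 1) = norm (U z - gamma_root z)"
        by (simp add: U_def norm_mult[symmetric] algebra_simps)
      finally show ?thesis
        by (simp add: \<epsilon>_def power2_eq_square mult_ac)
    qed
    fix x :: real assume x: "0 < x" "x < r"
    let ?z = "complex_of_real x"
    have z: "?z \<in> sector r" using x by (simp add: sector_def)
    define M where "M = (\<lambda>t. exp (ln p / x) * exp (ln_Gamma (1 + x) / x) * exp t)"
    have m_real: "m ?z (of_real t) = of_real (M t)" for t
      unfolding m_def M_def gamma_root_of_real[OF x(1)] by (simp add: exp_of_real[symmetric])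
    have y_real: "y ?z (of_real t) = of_real (x * inc_gamma_corr x (M t))" for t
      unfolding y_def m_real inc_gamma_corr_of_real[OF x(1)] by simp
    have pos: "1 + x * inc_gamma_corr x (M t) > 0" if "\<bar>t\<bar> \<le> 1" for t
    proof -
      have "\<bar>x * inc_gamma_corr x (M t)\<bar> \<le> 1 / 8"
        using y_small[OF z, of "of_real t"] that unfolding y_real by (simp only: norm_of_real)
      then show ?thesis by linarith
    qed
    have T_real: "T ?z (of_real t) = of_real (- ln (1 + x * inc_gamma_corr x (M t)) / x)"
      if "\<bar>t\<bar> \<le> 1" for t
      using Ln_of_real[OF pos[OF that]] unfolding T_def y_real by simp
    \<comment> \<open>A real fixed point is needed to recognize the extension as the real function \<open>u p\<close>.\<close>
    have "w ?z \<in> \<real>"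
    proof (rule w(4)[OF z])
      fix t :: complex assume "t \<in> \<real>" "norm t \<le> 1"
      then show "T ?z t \<in> \<real>" using T_real by (auto elim!: Reals_cases)
    qed
    then obtain t where t: "w ?z = of_real t" by (auto elim: Reals_cases)
    have t_le: "\<bar>t\<bar> \<le> 1" using w(2)[OF z] t by simp
    have "complex_of_real (- ln (1 + x * inc_gamma_corr x (M t)) / x) = of_real t"
      using w(3)[OF z] T_real[OF t_le] t by simp
    then have "- ln (1 + x * inc_gamma_corr x (M t)) / x = t"
      by (simp only: of_real_eq_iff)
    then have "ln (1 + x * inc_gamma_corr x (M t)) = - (x * t)"
      using x(1) by (simp add: field_simps)
    \<comment> \<open>This is the quantile equation for \<open>M t\<close>, up to taking the power with exponent \<open>x\<close>.\<close>
    then have fixp: "1 + x * inc_gamma_corr x (M t) = exp (- (x * t))"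
      using pos[OF t_le] by (metis exp_ln)
    have "M t = exp (ln p / x + ln_Gamma (1 + x) / x + t)"
      by (simp add: M_def exp_add)
    then have "M t powr x = exp (ln p + ln_Gamma (1 + x) + x * t)"
      using x(1) by (simp add: powr_def distrib_left)
    also have "\<dots> = p * Gamma (1 + x) * exp (x * t)"
      using assms x(1) by (simp add: exp_add Gamma_real_pos_exp)
    finally have powM: "M t powr x = p * Gamma (1 + x) * exp (x * t)" .
    have "M t powr x * (1 / x + inc_gamma_corr x (M t))
          = M t powr x * (1 + x * inc_gamma_corr x (M t)) / x"
      using x(1) by (simp add: field_simps)
    also have "\<dots> = p * Gamma (1 + x) / x"
      unfolding fixp powM by (simp add: exp_minus)
    also have "\<dots> = p * Gamma x"
    proof -
      have "x \<notin> \<int>\<^sub>\<le>\<^sub>0" using x(1) nonpos_Ints_nonpos[of x] by auto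
      then have "Gamma (1 + x) = x * Gamma x" using Gamma_plus1[of x] by (simp add: add.commute)
      then show ?thesis using x(1) by simp
    qed
    finally have "gamma_quantile p x = M t"
      using x(1) by (intro gamma_quantile_eqI) (auto simp: M_def)
    then have "u p x = exp (ln_Gamma (1 + x) / x) * exp t"
      unfolding u_def M_def by (simp add: exp_minus)
    then show "U ?z = of_real (u p x)"
      unfolding U_def t gamma_root_of_real[OF x(1)] by (simp add: exp_of_real[symmetric])
  qed
qed

section \<open>Taylor expansions of the derivatives of u at 0\<close>

lemma exp_neg_over_flat:
  fixes a :: real
  assumes "a < 0"
  shows "(\<lambda>x. exp (a / x)) \<in> O[at_right 0](\<lambda>x. x ^ k)"
proof (rule landau_o.small_imp_big[OF smalloI_tendsto])
  have "((\<lambda>y :: real. y ^ k / exp y) \<longlongrightarrow> 0) at_top"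
    by (rule tendsto_power_div_exp_0)
  moreover have "filterlim (\<lambda>x. - a / x) at_top (at_right 0)"
    using assms by real_asymp
  ultimately have "((\<lambda>x. (- a / x) ^ k / exp (- a / x)) \<longlongrightarrow> 0) (at_right 0)"
    by (rule filterlim_compose)
  then have "((\<lambda>x. 1 / (- a) ^ k * ((- a / x) ^ k / exp (- a / x))) \<longlongrightarrow> 0) (at_right 0)"
    by (rule tendsto_mult_right_zero)
  also have "(\<lambda>x. 1 / (- a) ^ k * ((- a / x) ^ k / exp (- a / x))) = (\<lambda>x. exp (a / x) / x ^ k)"
  proof
    fix x
    have "(- a / x) ^ k = (- a) ^ k / x ^ k"
      by (rule power_divide)
    then show "1 / (- a) ^ k * ((- a / x) ^ k / exp (- a / x)) = exp (a / x) / x ^ k"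
      using assms by (simp add: exp_minus inverse_eq_divide)
  qed
  finally show "((\<lambda>x. exp (a / x) / x ^ k) \<longlongrightarrow> 0) (at_right 0)" .
  show "\<forall>\<^sub>F x in at_right 0. x ^ k \<noteq> (0 :: real)"
    unfolding eventually_at_right_field by (intro exI[of _ 1]) auto
qed

text \<open>
  Cauchy's inequality on discs of radius \<open>x / 3\<close> costs only a factor \<open>x powr (- j)\<close>, which the
  exponential bound on \<open>u p - gamma_root\<close> absorbs. Hence \<open>u p\<close> and \<open>gamma_root\<close> have the same Taylor
  expansion at 0, to every order and after any number of differentiations.
\<close>
lemma higher_deriv_u_flat:
  assumes "0 < p" "p < 1"
  shows "(\<lambda>x. (deriv ^^ j) (u p) x - Re ((deriv ^^ j) gamma_root (of_real x)))
           \<in> O[at_right 0](\<lambda>x. x ^ N)"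
proof -
  obtain r U C where r: "0 < r" "r \<le> 1 / 4" and U: "U holomorphic_on sector r"
    and U_real: "\<And>x. 0 < x \<Longrightarrow> x < r \<Longrightarrow> U (of_real x) = of_real (u p x)"
    and close: "\<And>z. z \<in> sector r \<Longrightarrow> norm (U z - gamma_root z) \<le> C * exp (ln p / (2 * Re z))"
    by (rule gamma_quantile_sector_extension[OF assms], rule that, assumption+)
  have V: "gamma_root holomorphic_on sector r"
    by (rule holomorphic_on_subset[OF gamma_root_holomorphic]) (use r(2) sector_norm_less in force)
  define a where "a = 3 * ln p / 8"
  have lnp: "ln p < 0" using assms by simp
  have bound: "\<bar>(deriv ^^ j) (u p) x - Re ((deriv ^^ j) gamma_root (of_real x))\<bar>
      \<le> fact j * 3 ^ j * \<bar>C\<bar> * \<bar>exp (a / x) / x ^ j\<bar>" if x: "0 < x" "3 * x < 2 * r" for x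
  proof -
    let ?z = "complex_of_real x"
    have sub: "cball ?z (x / 3) \<subseteq> sector r"
      using cball_subset_sector[OF x] .
    have z: "?z \<in> sector r" using sub x by auto
    have real: "(deriv ^^ j) U ?z = of_real ((deriv ^^ j) (u p) x)"
      by (rule higher_deriv_of_real_restriction[OF U open_sector, of "{0<..<r}"])
         (use U_real x in \<open>auto simp: sector_def\<close>)
    have hol: "(\<lambda>z. U z - gamma_root z) holomorphic_on sector r"
      by (intro holomorphic_intros U V)
    have "norm ((deriv ^^ j) (\<lambda>z. U z - gamma_root z) ?z) \<le> fact j * (\<bar>C\<bar> * exp (a / x)) / (x / 3) ^ j"
    proof (rule Cauchy_inequality)
      show "(\<lambda>z. U z - gamma_root z) holomorphic_on ball ?z (x / 3)"
        using hol sub by (meson ball_subset_cball holomorphic_on_subset order_trans)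
      show "continuous_on (cball ?z (x / 3)) (\<lambda>z. U z - gamma_root z)"
        using hol sub holomorphic_on_imp_continuous_on holomorphic_on_subset by blast
      fix s assume s: "norm (?z - s) = x / 3"
      then have s_in: "s \<in> sector r" using sub by (auto simp: subset_iff dist_norm)
      \<comment> \<open>On the circle, \<open>Re s\<close> is at most \<open>4 * x / 3\<close>; this is where the constant 3/8 in \<open>a\<close> comes from.\<close>
      have "Re s \<le> 4 * x / 3"
        using s abs_Re_le_cmod[of "?z - s"] by simp
      moreover have "Re s > 0" using s_in by (simp add: sector_def)
      ultimately have "ln p / (2 * Re s) \<le> ln p / (2 * (4 * x / 3))"
        using lnp x by (intro divide_left_mono_neg) auto
      also have "\<dots> = a / x" by (simp add: a_def)
      finally have "C * exp (ln p / (2 * Re s)) \<le> \<bar>C\<bar> * exp (a / x)"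
        by (intro mult_mono) auto
      with close[OF s_in] show "norm (U s - gamma_root s) \<le> \<bar>C\<bar> * exp (a / x)"
        by linarith
    qed (use x in auto)
    also have "(deriv ^^ j) (\<lambda>z. U z - gamma_root z) ?z = (deriv ^^ j) U ?z - (deriv ^^ j) gamma_root ?z"
      by (rule higher_deriv_diff[OF U V open_sector z])
    finally have "norm (of_real ((deriv ^^ j) (u p) x) - (deriv ^^ j) gamma_root ?z)
        \<le> fact j * (\<bar>C\<bar> * exp (a / x)) / (x / 3) ^ j"
      unfolding real .
    moreover have "\<bar>(deriv ^^ j) (u p) x - Re ((deriv ^^ j) gamma_root ?z)\<bar>
        \<le> norm (of_real ((deriv ^^ j) (u p) x) - (deriv ^^ j) gamma_root ?z)"
      using abs_Re_le_cmod[of "of_real ((deriv ^^ j) (u p) x) - (deriv ^^ j) gamma_root ?z"] by simp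
    ultimately show ?thesis
      using x by (simp add: power_divide mult_ac)
  qed
  have "(\<lambda>x. (deriv ^^ j) (u p) x - Re ((deriv ^^ j) gamma_root (of_real x)))
      \<in> O[at_right 0](\<lambda>x. exp (a / x) / x ^ j)"
  proof (rule bigoI)
    show "\<forall>\<^sub>F x in at_right 0. norm ((deriv ^^ j) (u p) x - Re ((deriv ^^ j) gamma_root (of_real x)))
        \<le> fact j * 3 ^ j * \<bar>C\<bar> * norm (exp (a / x) / x ^ j)"
      unfolding eventually_at_right_field real_norm_def
      by (rule exI[of _ "r / 2"]) (use bound r in auto)
  qed
  also have "(\<lambda>x. exp (a / x) / x ^ j) \<in> O[at_right 0](\<lambda>x. x ^ (N + j) / x ^ j)"
  proof (rule landau_o.big.divide_right[OF _ exp_neg_over_flat])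
    show "\<forall>\<^sub>F x in at_right 0. x ^ j \<noteq> (0 :: real)"
      unfolding eventually_at_right_field by (intro exI[of _ 1]) auto
  qed (use lnp in \<open>simp add: a_def\<close>)
  also have "(\<lambda>x::real. x ^ (N + j) / x ^ j) \<in> \<Theta>[at_right 0](\<lambda>x. x ^ N)"
    by (rule bigthetaI_cong) (auto simp: power_add eventually_at_right_field intro: exI[of _ 1])
  finally show ?thesis .
qed

lemma higher_deriv_gamma_root_holomorphic: "(deriv ^^ j) gamma_root holomorphic_on ball 0 1"
  by (rule holomorphic_higher_deriv[OF gamma_root_holomorphic open_ball])

lemma u_deriv0_eq:
  assumes "0 < p" "p < 1"
  shows "u_deriv0 p j = Re ((deriv ^^ j) gamma_root 0)"
  unfolding u_deriv0_def
proof (rule tendsto_Lim[OF trivial_limit_at_right_real])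
  have "isCont ((deriv ^^ j) gamma_root) 0"
    using holomorphic_on_imp_continuous_on[OF higher_deriv_gamma_root_holomorphic]
    by (simp add: continuous_on_eq_continuous_at)
  then have "((\<lambda>x. (deriv ^^ j) gamma_root (of_real x)) \<longlongrightarrow> (deriv ^^ j) gamma_root 0) (at_right 0)"
    by (rule isCont_tendsto_compose) (intro tendsto_eq_intros, auto)
  then have "((\<lambda>x. Re ((deriv ^^ j) gamma_root (of_real x))) \<longlongrightarrow> Re ((deriv ^^ j) gamma_root 0)) (at_right 0)"
    by (rule tendsto_Re)
  moreover have "((\<lambda>x. (deriv ^^ j) (u p) x - Re ((deriv ^^ j) gamma_root (of_real x))) \<longlongrightarrow> 0) (at_right 0)"
  proof -
    have "(\<lambda>x::real. x ^ 1) \<in> o[at_right 0](\<lambda>_. 1)" by real_asymp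
    from smalloD_tendsto[OF landau_o.big_small_trans[OF higher_deriv_u_flat[OF assms, of j 1] this]]
    show ?thesis by simp
  qed
  ultimately show "((deriv ^^ j) (u p) \<longlongrightarrow> Re ((deriv ^^ j) gamma_root 0)) (at_right 0)"
    by (rule Lim_transform)
qed

lemma higher_deriv_u_expansion:
  assumes "0 < p" "p < 1"
  shows "(\<lambda>x. (deriv ^^ i) (u p) x - (\<Sum>j=0..N. u_deriv0 p (i + j) / fact j * x ^ j))
           \<in> O[at_right 0](\<lambda>x. x ^ Suc N)"
proof -
  let ?D = "\<lambda>j. (deriv ^^ (i + j)) gamma_root"
  have "bounded (?D (Suc N) ` cball 0 (1 / 2))"
    by (intro compact_imp_bounded compact_continuous_image
          holomorphic_on_imp_continuous_on[OF holomorphic_on_subset[OF higher_deriv_gamma_root_holomorphic]]) auto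
  then obtain B where B: "\<And>z. z \<in> cball 0 (1 / 2) \<Longrightarrow> norm (?D (Suc N) z) \<le> B"
    unfolding bounded_iff by blast
  have taylor: "\<bar>Re (?D 0 (of_real x)) - (\<Sum>j=0..N. u_deriv0 p (i + j) / fact j * x ^ j)\<bar>
      \<le> B / fact N * \<bar>x ^ Suc N\<bar>" if "0 < x" "x \<le> 1 / 2" for x
  proof -
    have "norm (?D 0 (of_real x) - (\<Sum>j\<le>N. ?D j 0 * (of_real x - 0) ^ j / fact j))
        \<le> B * norm (complex_of_real x - 0) ^ Suc N / fact N"
    proof (rule complex_Taylor[of "cball 0 (1 / 2)"])
      fix j and z :: complex assume "z \<in> cball 0 (1 / 2)"
      then have "(?D j has_field_derivative deriv (?D j) z) (at z)"
        by (intro holomorphic_derivI[OF higher_deriv_gamma_root_holomorphic open_ball]) auto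
      then show "(?D j has_field_derivative ?D (Suc j) z) (at z within cball 0 (1 / 2))"
        by (simp add: has_field_derivative_at_within)
    qed (use B that in auto)
    moreover have "Re (?D 0 (of_real x) - (\<Sum>j\<le>N. ?D j 0 * (of_real x - 0) ^ j / fact j))
        = Re (?D 0 (of_real x)) - (\<Sum>j=0..N. u_deriv0 p (i + j) / fact j * x ^ j)"
    proof -
      have "Re (?D j 0 * (of_real x - 0) ^ j / fact j) = u_deriv0 p (i + j) / fact j * x ^ j" for j
      proof -
        have "?D j 0 * (of_real x - 0) ^ j / fact j = of_real (x ^ j / fact j) * ?D j 0"
          by simp
        also have "Re \<dots> = x ^ j / fact j * Re (?D j 0)"
          by (simp only: times_complex.sel Re_complex_of_real Im_complex_of_real mult_zero_left diff_zero)
        finally show ?thesis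
          unfolding u_deriv0_eq[OF assms] by simp
      qed
      then show ?thesis by (simp add: atLeast0AtMost)
    qed
    ultimately show ?thesis
      using abs_Re_le_cmod[of "?D 0 (of_real x) - (\<Sum>j\<le>N. ?D j 0 * (of_real x - 0) ^ j / fact j)"] that
      by simp
  qed
  have "(\<lambda>x. Re (?D 0 (of_real x)) - (\<Sum>j=0..N. u_deriv0 p (i + j) / fact j * x ^ j))
      \<in> O[at_right 0](\<lambda>x. x ^ Suc N)"
  proof (rule bigoI)
    show "\<forall>\<^sub>F x in at_right 0. norm (Re (?D 0 (of_real x)) - (\<Sum>j=0..N. u_deriv0 p (i + j) / fact j * x ^ j))
        \<le> B / fact N * norm (x ^ Suc N)"
      unfolding eventually_at_right_field real_norm_def
      by (rule exI[of _ "1 / 2"]) (use taylor in auto)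
  qed
  from sum_in_bigo(1)[OF higher_deriv_u_flat[OF assms, of i "Suc N"] this]
  show ?thesis by simp
qed

section \<open>The first two Taylor coefficients\<close>

text \<open>
  Differentiate \<open>z * log_gamma_slope z = ln_Gamma (1 + z)\<close> twice at 0.
\<close>
lemma deriv_log_gamma_slope_0: "deriv log_gamma_slope 0 = Polygamma 1 1 / 2"
proof -
  let ?d = "deriv log_gamma_slope"
  have d: "(log_gamma_slope has_field_derivative ?d z) (at z)" if "norm z < 1" for z
    using holomorphic_derivI[OF log_gamma_slope_holomorphic open_ball] that by auto
  have "?d holomorphic_on ball 0 1"
    by (intro holomorphic_deriv log_gamma_slope_holomorphic open_ball)
  then have d2: "(?d has_field_derivative deriv ?d 0) (at 0)"
    by (intro holomorphic_derivI[of _ "ball 0 1"]) auto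
  have Digamma_eq: "Digamma (1 + z) = log_gamma_slope z + z * ?d z" if "z \<in> ball 0 1" for z
  proof (rule DERIV_unique)
    have "((\<lambda>z. z * log_gamma_slope z) has_field_derivative log_gamma_slope z + z * ?d z) (at z)"
      using d[of z] that by (auto intro!: derivative_eq_intros)
    moreover have "z * log_gamma_slope z = ln_Gamma (1 + z)" for z
      using ln_Gamma_complex_conv_fact[of 1] by (simp add: log_gamma_slope_def)
    ultimately show "((\<lambda>z. ln_Gamma (1 + z)) has_field_derivative log_gamma_slope z + z * ?d z) (at z)"
      by simp
    show "((\<lambda>z. ln_Gamma (1 + z)) has_field_derivative Digamma (1 + z)) (at z)"
      using has_field_derivative_ln_Gamma_one_plus[of z] that by simp
  qed
  have "((\<lambda>z. log_gamma_slope z + z * ?d z) has_field_derivative 2 * ?d 0) (at 0)"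
    using d[of 0] d2 by (auto intro!: derivative_eq_intros)
  then have "((\<lambda>z. Digamma (1 + z)) has_field_derivative 2 * ?d 0) (at 0)"
    by (rule has_field_derivative_transform_within_open[of _ _ _ "ball 0 1"]) (use Digamma_eq in auto)
  moreover have "((\<lambda>z. Digamma (1 + z)) has_field_derivative Polygamma 1 1) (at (0 :: complex))"
    by (auto intro!: derivative_eq_intros)
  ultimately have "2 * ?d 0 = Polygamma 1 1"
    by (rule DERIV_unique)
  then have "?d 0 = Polygamma 1 1 / 2" by (simp add: eq_divide_eq mult.commute)
  then show ?thesis .
qed

lemma gamma_root_0: "gamma_root 0 = of_real (exp (- euler_mascheroni))"
  by (simp add: gamma_root_def log_gamma_slope_def exp_of_real[symmetric])

lemma u_deriv0_0:
  assumes "0 < p" "p < 1"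
  shows "u_deriv0 p 0 = exp (- euler_mascheroni)"
  unfolding u_deriv0_eq[OF assms]
  by (simp add: gamma_root_0)

lemma u_deriv0_1:
  assumes "0 < p" "p < 1"
  shows "u_deriv0 p 1 = exp (- euler_mascheroni) * (Polygamma 1 1 / 2)"
proof -
  have "(log_gamma_slope has_field_derivative Polygamma 1 1 / 2) (at 0)"
    using holomorphic_derivI[OF log_gamma_slope_holomorphic open_ball, of 0] deriv_log_gamma_slope_0 by simp
  then have "(gamma_root has_field_derivative exp (log_gamma_slope 0) * (Polygamma 1 1 / 2)) (at 0)"
    unfolding gamma_root_def[abs_def] by (rule DERIV_fun_exp)
  then have "deriv gamma_root 0 = gamma_root 0 * (Polygamma 1 1 / 2)"
    unfolding gamma_root_def by (rule DERIV_imp_deriv)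
  also have "\<dots> = of_real (exp (- euler_mascheroni) * (Polygamma 1 1 / 2))"
    using Polygamma_of_real[of 1 1, where 'a = complex] by (simp add: gamma_root_0)
  finally have "deriv gamma_root 0 = of_real (exp (- euler_mascheroni) * (Polygamma 1 1 / 2))" .
  then have "Re ((deriv ^^ 1) gamma_root 0) = exp (- euler_mascheroni) * (Polygamma 1 1 / 2)"
    by (simp only: One_nat_def funpow.simps comp_apply id_apply Re_complex_of_real)
  then show ?thesis
    unfolding u_deriv0_eq[OF assms] .
qed

section \<open>Evaluation of s1\<close>

text \<open>
  L'Hopital's rule, applied once, leaves the mean of the difference quotients of \<open>F'\<close> at 0 with
  increments \<open>h\<close> and \<open>- h\<close>, and both converge to \<open>D\<close>.
\<close>
lemma symmetric_second_difference:
  fixes F F' :: "real \<Rightarrow> real"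
  assumes F: "\<And>h. \<bar>h\<bar> < 1 \<Longrightarrow> (F has_real_derivative F' h) (at h)"
    and F': "(F' has_real_derivative D) (at 0)"
  shows "((\<lambda>h. (F h + F (- h) - 2 * F 0) / h\<^sup>2) \<longlongrightarrow> D) (at_right 0)"
proof (rule lhopital_right_0[where f' = "\<lambda>h. F' h - F' (- h)" and g' = "\<lambda>h. 2 * h"])
  have ev: "\<forall>\<^sub>F h in at_right 0. 0 < h \<and> h < (1 :: real)"
    unfolding eventually_at_right_field by (intro exI[of _ 1]) auto
  have cont: "isCont F 0" using F[of 0] by (auto intro: DERIV_isCont)
  have "(F \<longlongrightarrow> F 0) (at_right 0)"
    using cont by (auto simp: isCont_def intro: tendsto_mono[OF at_le])
  moreover have "((\<lambda>h. F (- h)) \<longlongrightarrow> F 0) (at_right 0)"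
    by (rule isCont_tendsto_compose[OF cont]) (auto intro!: tendsto_eq_intros)
  ultimately show "((\<lambda>h. F h + F (- h) - 2 * F 0) \<longlongrightarrow> 0) (at_right 0)"
    by (auto intro!: tendsto_eq_intros)
  show "((\<lambda>h. h\<^sup>2) \<longlongrightarrow> (0 :: real)) (at_right 0)"
    by (auto intro!: tendsto_eq_intros)
  show "\<forall>\<^sub>F h in at_right 0. h\<^sup>2 \<noteq> (0 :: real)" "\<forall>\<^sub>F h in at_right 0. 2 * h \<noteq> (0 :: real)"
    using ev by (auto elim: eventually_mono)
  show "\<forall>\<^sub>F h in at_right 0. ((\<lambda>h. F h + F (- h) - 2 * F 0) has_real_derivative F' h - F' (- h)) (at h)"
    using ev
  proof eventually_elim
    case (elim h)
    have "((\<lambda>h. F (- h)) has_real_derivative F' (- h) * (- 1)) (at h)"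
      using elim by (intro DERIV_chain2[OF F]) (auto intro!: derivative_eq_intros)
    then show ?case
      using F[of h] elim by (auto intro!: derivative_eq_intros)
  qed
  show "\<forall>\<^sub>F h in at_right 0. ((\<lambda>h. h\<^sup>2) has_real_derivative 2 * h) (at (h :: real))"
    by (intro always_eventually allI) (auto intro!: derivative_eq_intros)
  have *: "((\<lambda>h. (F' h - F' 0) / h) \<longlongrightarrow> D) (at 0)"
    using F' by (simp add: DERIV_def)
  have "((\<lambda>h. (F' h - F' 0) / h) \<longlongrightarrow> D) (at_right 0)"
    by (rule tendsto_mono[OF at_le *]) auto
  moreover have "((\<lambda>h. (F' (- h) - F' 0) / (- h)) \<longlongrightarrow> D) (at_right 0)"
    by (rule filterlim_compose[OF *])
       (auto simp: filterlim_at eventually_at_right_field intro!: tendsto_eq_intros exI[of _ 1])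
  ultimately have "((\<lambda>h. ((F' h - F' 0) / h + (F' (- h) - F' 0) / (- h)) / 2) \<longlongrightarrow> (D + D) / 2) (at_right 0)"
    by (intro tendsto_divide tendsto_add) auto
  also have "(\<lambda>h. ((F' h - F' 0) / h + (F' (- h) - F' 0) / (- h)) / 2) = (\<lambda>h. (F' h - F' (- h)) / (2 * h))"
    by (auto simp: fun_eq_iff divide_simps)
  finally show "((\<lambda>h. (F' h - F' (- h)) / (2 * h)) \<longlongrightarrow> D) (at_right 0)" by simp
qed

lemma one_plus_notin_nonpos_Ints_real: "\<bar>h\<bar> < 1 \<Longrightarrow> 1 + h \<notin> \<int>\<^sub>\<le>\<^sub>0" for h :: real
  using nonpos_Ints_nonpos[of "1 + h"] by auto

lemma Gamma_second_difference_at_1: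
  "((\<lambda>h. (Gamma (1 + h) + Gamma (1 - h) - 2) / h\<^sup>2) \<longlongrightarrow> Polygamma 1 1 + euler_mascheroni\<^sup>2) (at_right (0::real))"
proof -
  have "((\<lambda>h. (Gamma (1 + h) + Gamma (1 + - h) - 2 * Gamma (1 + 0)) / h\<^sup>2) \<longlongrightarrow>
           Polygamma 1 1 + euler_mascheroni\<^sup>2) (at_right (0::real))"
  proof (rule symmetric_second_difference[where F = "\<lambda>h. Gamma (1 + h)"])
    show "((\<lambda>h. Gamma (1 + h)) has_real_derivative Gamma (1 + h) * Digamma (1 + h)) (at h)"
      if "\<bar>h\<bar> < 1" for h :: real
      using one_plus_notin_nonpos_Ints_real[OF that] by (auto intro!: derivative_eq_intros)
    show "((\<lambda>h. Gamma (1 + h) * Digamma (1 + h)) has_real_derivative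
             Polygamma 1 1 + euler_mascheroni\<^sup>2) (at (0::real))"
      by (auto intro!: derivative_eq_intros simp: power2_eq_square)
  qed
  then show ?thesis by simp
qed

text \<open>
  The quotient \<open>sinh y / y\<close> grows with \<open>\<bar>y\<bar>\<close>; halving \<open>h\<close> therefore makes the quotient below smaller.
  This makes the largest of the functions in the next lemma an integrable majorant of all others.
\<close>
lemma two_sinh_half_over_halving:
  fixes L h :: real
  assumes "h > 0"
  shows "(2 * sinh (h / 2 * L / 2) / (h / 2))\<^sup>2 \<le> (2 * sinh (h * L / 2) / h)\<^sup>2"
proof -
  have "sinh (h * L / 2) = 2 * sinh (h / 2 * L / 2) * cosh (h / 2 * L / 2)"
    using sinh_double[of "h / 2 * L / 2"] by (simp add: mult.commute)
  then have "(2 * sinh (h * L / 2) / h)\<^sup>2 = (2 * sinh (h / 2 * L / 2) / (h / 2))\<^sup>2 * (cosh (h / 2 * L / 2))\<^sup>2"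
    by (simp add: power2_eq_square)
  moreover have "1 \<le> (cosh (h / 2 * L / 2))\<^sup>2"
    using cosh_real_ge_1 one_le_power by blast
  ultimately show ?thesis
    using mult_left_mono[of 1 "(cosh (h / 2 * L / 2))\<^sup>2" "(2 * sinh (h / 2 * L / 2) / (h / 2))\<^sup>2"] by simp
qed

text \<open>
  The integral is the second derivative of \<open>Gamma\<close> at 1. It is obtained from the second differences
  \<open>(Gamma (1 + h) + Gamma (1 - h) - 2 * Gamma 1) / h\<^sup>2\<close>, whose integrands
  \<open>exp (- s) * (s powr h + s powr (- h) - 2) / h\<^sup>2 = exp (- s) * (2 * sinh (h * ln s / 2) / h)\<^sup>2\<close>
  converge dominatedly as \<open>h\<close> runs through the powers of 1/2.
\<close>
lemma has_integral_exp_ln_squared: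
  "((\<lambda>s. exp (- s) * (ln s)\<^sup>2) has_integral (Polygamma 1 1 + euler_mascheroni\<^sup>2)) {0::real..}"
proof -
  define h where "h = (\<lambda>k. (1 / 2 :: real) ^ Suc k)"
  have h: "0 < h k" "h k < 1" for k
    unfolding h_def by (simp, rule power_Suc_less_one) auto
  define f where "f = (\<lambda>k s. (s powr (1 + h k - 1) / exp s + s powr (1 - h k - 1) / exp s
                                - 2 * (s powr (1 - 1) / exp s)) / (h k)\<^sup>2)"
  have f_int: "(f k has_integral (Gamma (1 + h k) + Gamma (1 - h k) - 2 * Gamma 1) / (h k)\<^sup>2) {0..}" for k
    unfolding f_def
    by (intro has_integral_divide has_integral_diff has_integral_add has_integral_mult_right Gamma_integral_real)
       (use h[of k] in auto)
  have f_eq: "f k s = exp (- s) * (2 * sinh (h k * ln s / 2) / h k)\<^sup>2" if "s \<ge> 0" for k s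
  proof (cases "s = 0")
    case True
    then show ?thesis by (simp add: f_def)
  next
    case False
    then have "s > 0" using that by simp
    define e where "e = exp (h k * ln s / 2)"
    have e: "e > 0" by (simp add: e_def)
    have "s powr h k = e * e" "s powr (- h k) = inverse e * inverse e"
      using \<open>s > 0\<close> by (simp_all add: e_def powr_def flip: exp_add exp_minus)
    moreover have "2 * sinh (h k * ln s / 2) = e - inverse e"
      by (simp add: sinh_def e_def exp_minus)
    moreover have "e * e + inverse e * inverse e - 2 = (e - inverse e)\<^sup>2"
      using e by (simp add: power2_eq_square algebra_simps)
    ultimately have "s powr h k + s powr (- h k) - 2 = (2 * sinh (h k * ln s / 2))\<^sup>2"
      by (simp only:)
    moreover have "f k s = exp (- s) * (s powr h k + s powr (- h k) - 2) / (h k)\<^sup>2"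
    proof -
      have "s powr h k / exp s + s powr (- h k) / exp s - 2 * (1 / exp s)
          = exp (- s) * (s powr h k + s powr (- h k) - 2)"
        by (simp add: exp_minus divide_inverse algebra_simps)
      then show ?thesis using \<open>s > 0\<close> by (simp add: f_def)
    qed
    ultimately show ?thesis
      by (simp add: power_divide)
  qed
  have f_le: "f k s \<le> f 0 s" if "s \<ge> 0" for k s
  proof (induction k)
    case (Suc k)
    have half: "h (Suc k) = h k / 2" by (simp add: h_def)
    have "f (Suc k) s \<le> f k s"
      unfolding f_eq[OF that] half using two_sinh_half_over_halving[of "h k" "ln s"] h[of k]
      by (intro mult_left_mono) auto
    with Suc show ?case by simp
  qed simp
  have h_lim: "h \<longlonglongrightarrow> 0"
    unfolding h_def by (intro LIMSEQ_Suc LIMSEQ_realpow_zero) auto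
  have f_lim: "(\<lambda>k. f k s) \<longlonglongrightarrow> exp (- s) * (ln s)\<^sup>2" if "s \<ge> 0" for s
  proof -
    have "((\<lambda>t. 2 * sinh (t * ln s / 2)) has_real_derivative ln s) (at 0)"
      by (auto intro!: derivative_eq_intros)
    then have "((\<lambda>t. 2 * sinh (t * ln s / 2) / t) \<longlongrightarrow> ln s) (at 0)"
      by (simp add: DERIV_def)
    moreover have "filterlim h (at 0) sequentially"
      using h_lim h(1) by (auto simp: filterlim_at less_imp_neq[symmetric] intro!: always_eventually)
    ultimately have "(\<lambda>k. 2 * sinh (h k * ln s / 2) / h k) \<longlonglongrightarrow> ln s"
      by (rule filterlim_compose)
    then show ?thesis
      unfolding f_eq[OF that] by (intro tendsto_intros)
  qed
  have f_integrable: "f k integrable_on {0..}" for k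
    using f_int by (rule has_integral_integrable)
  have f_norm: "norm (f k s) \<le> f 0 s" if "s \<in> {0..}" for k s
  proof -
    have "f k s \<ge> 0" using f_eq[of s k] that by simp
    then show ?thesis using f_le[of s k] that by simp
  qed
  have f_lim': "(\<lambda>k. f k s) \<longlonglongrightarrow> exp (- s) * (ln s)\<^sup>2" if "s \<in> {0..}" for s
    using f_lim that by simp
  have dom: "(\<lambda>s :: real. exp (- s) * (ln s)\<^sup>2) integrable_on {0..}"
    "(\<lambda>k. integral {0..} (f k)) \<longlonglongrightarrow> integral {0..} (\<lambda>s. exp (- s) * (ln s)\<^sup>2)"
    by (rule dominated_convergence[OF f_integrable f_integrable[of 0] f_norm f_lim']; assumption)+
  have "(\<lambda>k. (Gamma (1 + h k) + Gamma (1 - h k) - 2) / (h k)\<^sup>2) \<longlonglongrightarrow> Polygamma 1 1 + euler_mascheroni\<^sup>2"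
    by (rule filterlim_compose[OF Gamma_second_difference_at_1])
       (use h_lim h(1) in \<open>simp add: filterlim_at less_imp_neq[symmetric]\<close>)
  also have "(\<lambda>k. (Gamma (1 + h k) + Gamma (1 - h k) - 2) / (h k)\<^sup>2) = (\<lambda>k. integral {0..} (f k))"
    using integral_unique[OF f_int] by simp
  finally have "integral {0..} (\<lambda>s :: real. exp (- s) * (ln s)\<^sup>2) = Polygamma 1 1 + euler_mascheroni\<^sup>2"
    by (rule LIMSEQ_unique[OF dom(2)])
  with integrable_integral[OF dom(1)] show ?thesis by simp
qed

lemma has_integral_FTC_at_top:
  fixes F f :: "real \<Rightarrow> real"
  assumes F: "\<And>s. s \<ge> c \<Longrightarrow> (F has_real_derivative f s) (at s)"
    and lim: "(F \<longlongrightarrow> L) at_top"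
    and dom: "g integrable_on {c..}" "\<And>s. s \<ge> c \<Longrightarrow> \<bar>f s\<bar> \<le> g s"
  shows "(f has_integral L - F c) {c..}"
proof -
  define fk where "fk = (\<lambda>k s. if s \<in> {c..c + real k} then f s else 0)"
  have "(f has_integral F (c + real k) - F c) {c..c + real k}" for k
    by (rule fundamental_theorem_of_calculus)
       (use F in \<open>auto simp: has_real_derivative_iff_has_vector_derivative[symmetric] intro: has_field_derivative_at_within\<close>)
  then have fk: "(fk k has_integral F (c + real k) - F c) {c..}" for k
    unfolding fk_def by (subst has_integral_restrict) auto
  have fk_lim: "(\<lambda>k. fk k s) \<longlonglongrightarrow> f s" if "s \<in> {c..}" for s
  proof (rule tendsto_eventually)
    show "\<forall>\<^sub>F k in sequentially. fk k s = f s"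
      using eventually_ge_at_top[of "nat \<lceil>s - c\<rceil>"]
    proof eventually_elim
      case (elim k)
      then have "s \<le> c + real k" by linarith
      then show ?case using that by (simp add: fk_def)
    qed
  qed
  have fk_le: "norm (fk k s) \<le> g s" if "s \<in> {c..}" for k s
    using dom(2)[of s] that by (auto simp: fk_def)
  have fk_integrable: "fk k integrable_on {c..}" for k
    using fk by (rule has_integral_integrable)
  have int: "f integrable_on {c..}" "(\<lambda>k. integral {c..} (fk k)) \<longlonglongrightarrow> integral {c..} f"
    by (rule dominated_convergence[OF fk_integrable dom(1) fk_le fk_lim]; assumption)+
  have "filterlim (\<lambda>k. c + real k) at_top sequentially"
    by real_asymp
  then have "(\<lambda>k. F (c + real k) - F c) \<longlonglongrightarrow> L - F c"
    by (intro tendsto_diff filterlim_compose[OF lim] tendsto_const)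
  then have "integral {c..} f = L - F c"
    using LIMSEQ_unique[OF int(2)] integral_unique[OF fk] by simp
  with integrable_integral[OF int(1)] show ?thesis by simp
qed

text \<open>
  Integrate both parts of \<open>s1\<close> by parts, with \<open>(ln s)\<^sup>2 / 2\<close> as antiderivative of \<open>ln s / s\<close>. The
  boundary terms at \<open>c = exp (- euler_mascheroni)\<close> add up to \<open>- euler_mascheroni\<^sup>2 / 2\<close>, and what
  remains is half of the integral of \<open>exp (- s) * (ln s)\<^sup>2\<close>, whose value contains the same square.
\<close>
lemma s1_eq: "s1 = Polygamma 1 1 / 2"
proof -
  define c :: real where "c = exp (- euler_mascheroni)"
  let ?g = "\<lambda>s :: real. exp (- s) * (ln s)\<^sup>2"
  have c: "c > 0" "ln c = - euler_mascheroni" by (simp_all add: c_def)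
  have g_abs: "?g absolutely_integrable_on {0..}"
    using has_integral_exp_ln_squared by (intro nonnegative_absolutely_integrable_1) auto
  have g_int: "?g integrable_on {0..c}" "?g integrable_on {c..}"
    by (rule set_lebesgue_integral_eq_integral(1)[OF set_integrable_subset[OF g_abs]]; use c(1) in simp)+
  have "(?g has_integral integral {0..c} ?g + integral {c..} ?g) ({0..c} \<union> {c..})"
    using g_int by (intro has_integral_Un integrable_integral) (auto simp: c(1) less_imp_le Int_atLeastAtMost intro: negligible_subset[of "{c}"])
  moreover have "{0..c} \<union> {c..} = {0..}" using c(1) by auto
  ultimately have J: "integral {0..c} ?g + integral {c..} ?g = Polygamma 1 1 + euler_mascheroni\<^sup>2"
    using has_integral_unique[OF _ has_integral_exp_ln_squared] by simp
  have "((\<lambda>s. (exp (- s) - 1) / s * ln s - ?g s / 2) has_integral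
          (exp (- c) - 1) * (ln c)\<^sup>2 / 2 - (exp (- 0) - 1) * (ln 0)\<^sup>2 / 2) {0..c}"
  proof (rule fundamental_theorem_of_calculus_interior)
    show "continuous_on {0..c} (\<lambda>s. (exp (- s) - 1) * (ln s)\<^sup>2 / 2)"
      unfolding continuous_on_eq_continuous_within
    proof
      fix s assume s: "s \<in> {0..c}"
      show "continuous (at s within {0..c}) (\<lambda>s. (exp (- s) - 1) * (ln s)\<^sup>2 / 2)"
      proof (cases "s = 0")
        case True
        have "((\<lambda>s :: real. (exp (- s) - 1) * (ln s)\<^sup>2 / 2) \<longlongrightarrow> 0) (at_right 0)"
          by real_asymp
        then show ?thesis
          using True c(1) by (simp add: continuous_within at_within_Icc_at_right)
      next
        case False
        then show ?thesis using s by (auto intro!: continuous_intros)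
      qed
    qed
    fix s assume "s \<in> {0<..<c}"
    then have "((\<lambda>s. (exp (- s) - 1) * (ln s)\<^sup>2 / 2) has_real_derivative
        (exp (- s) - 1) / s * ln s - ?g s / 2) (at s)"
      by (auto intro!: derivative_eq_intros simp: field_simps power2_eq_square)
    then show "((\<lambda>s. (exp (- s) - 1) * (ln s)\<^sup>2 / 2) has_vector_derivative
        (exp (- s) - 1) / s * ln s - ?g s / 2) (at s)"
      by (simp add: has_real_derivative_iff_has_vector_derivative)
  qed (use c in auto)
  from has_integral_add[OF this has_integral_divide[OF integrable_integral[OF g_int(1)], of 2]]
  have I1: "integral {0..c} (\<lambda>s. (exp (- s) - 1) / s * ln s)
      = (exp (- c) - 1) * euler_mascheroni\<^sup>2 / 2 + integral {0..c} ?g / 2"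
    using c(2) by (intro integral_unique) simp
  have "((\<lambda>s. exp (- s) / s * ln s - ?g s / 2) has_integral 0 - ?g c / 2) {c..}"
  proof (rule has_integral_FTC_at_top)
    fix s assume s: "s \<ge> c"
    then show "((\<lambda>s. ?g s / 2) has_real_derivative exp (- s) / s * ln s - ?g s / 2) (at s)"
      using c(1) by (auto intro!: derivative_eq_intros simp: field_simps power2_eq_square)
    \<comment> \<open>A majorant made of \<open>exp (- s)\<close> and \<open>exp (- s) * (ln s)\<^sup>2\<close>, both integrable on the half-line.\<close>
    have "\<bar>ln s\<bar> \<le> 1 + (ln s)\<^sup>2"
      using zero_le_power2[of "\<bar>ln s\<bar> - 1 / 2"] by (simp add: power2_eq_square algebra_simps)
    then have "exp (- s) * \<bar>ln s\<bar> * (1 / s) \<le> exp (- s) * (1 + (ln s)\<^sup>2) * (1 / c)"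
      using s c(1) by (intro mult_mono frac_le) auto
    then have "\<bar>exp (- s) / s * ln s\<bar> \<le> exp (- s) * (1 + (ln s)\<^sup>2) * (1 / c)"
      using s c(1) by (simp add: abs_mult)
    moreover have "\<bar>exp (- s) / s * ln s - ?g s / 2\<bar> \<le> \<bar>exp (- s) / s * ln s\<bar> + ?g s"
    proof -
      have "?g s \<ge> 0" by simp
      then show ?thesis
        using abs_triangle_ineq4[of "exp (- s) / s * ln s" "?g s / 2"] by linarith
    qed
    ultimately show "\<bar>exp (- s) / s * ln s - ?g s / 2\<bar> \<le> (exp (- s) + ?g s) * (1 / c) + ?g s"
      by (simp add: distrib_left)
  next
    show "((\<lambda>s. ?g s / 2) \<longlongrightarrow> 0) at_top" by real_asymp
    have "(\<lambda>s. exp (- s)) integrable_on {c..}"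
      using integrable_on_exp_minus_to_infinity[of 1 c] by simp
    then show "(\<lambda>s. (exp (- s) + ?g s) * (1 / c) + ?g s) integrable_on {c..}"
      using g_int by (intro integrable_add integrable_on_mult_left) auto
  qed
  from has_integral_add[OF this has_integral_divide[OF integrable_integral[OF g_int(2)], of 2]]
  have I2: "integral {c..} (\<lambda>s. exp (- s) / s * ln s)
      = - exp (- c) * euler_mascheroni\<^sup>2 / 2 + integral {c..} ?g / 2"
    using c(2) by (intro integral_unique) simp
  show ?thesis
    using J unfolding s1_def I1[unfolded c_def] I2[unfolded c_def] by (simp add: c_def[symmetric] field_simps)
qed

section \<open>The expansion of the derivatives of the quantile\<close>

text \<open>
  The quantile is \<open>exp (ln p / x) * u p x\<close>. This is the product rule of order \<open>n\<close>, with the derivatives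
  of the exponential written out and the exponential itself divided off; no error term is involved.
\<close>
lemma higher_deriv_gamma_quantile:
  assumes "0 < p" "p < 1"
  shows "\<forall>\<^sub>F x in at_right 0. exp (- ln p / x) * (deriv ^^ n) (gamma_quantile p) x
      = (deriv ^^ n) (u p) x
        + (\<Sum>k=1..n. \<Sum>l=1..k. real (n choose k) * of_int (exp_inv_coeff (l + k) k) * (- ln p) ^ l
             * ((deriv ^^ (n - k)) (u p) x / x ^ (k + l)))"
proof -
  obtain r U C where r: "0 < r" and U: "U holomorphic_on sector r"
    and U_real: "\<And>x. 0 < x \<Longrightarrow> x < r \<Longrightarrow> U (of_real x) = of_real (u p x)"
    by (rule gamma_quantile_sector_extension[OF assms], rule that, assumption+)
  define c where "c = - ln p"
  have c: "c > 0" using assms by (simp add: c_def)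
  let ?Er = "\<lambda>x. exp (- c / x) :: real"
  let ?E = "\<lambda>z. exp (of_real (- c) / z) :: complex"
  have E: "?E holomorphic_on sector r"
    by (intro holomorphic_intros) (auto simp: sector_def)
  have eq: "exp (- ln p / x) * (deriv ^^ n) (gamma_quantile p) x
      = (deriv ^^ n) (u p) x
        + (\<Sum>k=1..n. \<Sum>l=1..k. real (n choose k) * of_int (exp_inv_coeff (l + k) k) * (- ln p) ^ l
             * ((deriv ^^ (n - k)) (u p) x / x ^ (k + l)))" if x: "0 < x" "x < r" for x
  proof -
    let ?z = "complex_of_real x"
    have in_sector: "of_real t \<in> sector r" if "t \<in> {0<..<r}" for t :: real
      using that by (simp add: sector_def)
    have dU: "(deriv ^^ j) U ?z = of_real ((deriv ^^ j) (u p) x)" for j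
      by (rule higher_deriv_of_real_restriction[OF U open_sector open_greaterThanLessThan in_sector])
         (use U_real x in auto)
    have dE: "(deriv ^^ j) ?E ?z = of_real ((deriv ^^ j) ?Er x)" for j
      by (rule higher_deriv_of_real_restriction[OF E open_sector open_greaterThanLessThan in_sector])
         (use x in \<open>auto simp: exp_of_real[symmetric]\<close>)
    have "(deriv ^^ n) (\<lambda>z. ?E z * U z) ?z = of_real ((deriv ^^ n) (gamma_quantile p) x)"
    proof (rule higher_deriv_of_real_restriction[OF _ open_sector open_greaterThanLessThan in_sector])
      show "(\<lambda>z. ?E z * U z) holomorphic_on sector r" by (intro holomorphic_intros E U)
      fix t assume "t \<in> {0<..<r}"
      then have t: "0 < t" "t < r" by auto
      have "?E (of_real t) * U (of_real t) = of_real (?Er t * u p t)"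
        using U_real[OF t] by (simp add: exp_of_real[symmetric])
      also have "?Er t * u p t = gamma_quantile p t"
        by (simp add: u_def c_def exp_minus)
      finally show "?E (of_real t) * U (of_real t) = of_real (gamma_quantile p t)" .
    qed (use x in auto)
    also have "(deriv ^^ n) (\<lambda>z. ?E z * U z) ?z
        = (\<Sum>k=0..n. of_nat (n choose k) * (deriv ^^ k) ?E ?z * (deriv ^^ (n - k)) U ?z)"
      by (rule higher_deriv_mult[OF E U open_sector in_sector]) (use x in auto)
    also have "\<dots> = of_real (\<Sum>k=0..n. real (n choose k) * (deriv ^^ k) ?Er x * (deriv ^^ (n - k)) (u p) x)"
      unfolding dU dE by simp
    finally have leibniz: "(deriv ^^ n) (gamma_quantile p) x
        = (\<Sum>k=0..n. real (n choose k) * (deriv ^^ k) ?Er x * (deriv ^^ (n - k)) (u p) x)"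
      by (simp only: of_real_eq_iff)
    have dEr: "exp (c / x) * (deriv ^^ k) ?Er x
        = (\<Sum>l=1..k. of_int (exp_inv_coeff (l + k) k) * c ^ l / x ^ (k + l))" if "k \<ge> 1" for k
    proof -
      have "exp (c / x) * (deriv ^^ k) ?Er x = poly (exp_inv_poly k) (c / x) / c ^ k"
        using higher_deriv_exp_inv[OF x(1) c, of k] by (simp add: exp_minus)
      also have "\<dots> = (\<Sum>i=1+k..k+k. coeff (exp_inv_poly k) i * (c / x) ^ i / c ^ k)"
        unfolding poly_exp_inv_poly[OF that] sum_divide_distrib by (simp add: mult_2)
      also have "\<dots> = (\<Sum>l=1..k. coeff (exp_inv_poly k) (l + k) * (c / x) ^ (l + k) / c ^ k)"
        by (rule sum.shift_bounds_cl_nat_ivl)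
      also have "\<dots> = (\<Sum>l=1..k. of_int (exp_inv_coeff (l + k) k) * c ^ l / x ^ (k + l))"
        unfolding of_int_exp_inv_coeff[OF that] using c x(1)
        by (intro sum.cong refl) (simp add: power_add power_divide mult_ac)
      finally show ?thesis .
    qed
    have "exp (c / x) * (deriv ^^ n) (gamma_quantile p) x
        = exp (c / x) * (real (n choose 0) * (deriv ^^ 0) ?Er x * (deriv ^^ (n - 0)) (u p) x)
          + (\<Sum>k=1..n. exp (c / x) * (real (n choose k) * (deriv ^^ k) ?Er x * (deriv ^^ (n - k)) (u p) x))"
      unfolding leibniz by (simp add: sum.atLeast_Suc_atMost distrib_left sum_distrib_left)
    also have "exp (c / x) * (real (n choose 0) * (deriv ^^ 0) ?Er x * (deriv ^^ (n - 0)) (u p) x) = (deriv ^^ n) (u p) x"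
      by (simp add: exp_minus)
    also have "(\<Sum>k=1..n. exp (c / x) * (real (n choose k) * (deriv ^^ k) ?Er x * (deriv ^^ (n - k)) (u p) x))
        = (\<Sum>k=1..n. \<Sum>l=1..k. real (n choose k) * of_int (exp_inv_coeff (l + k) k) * c ^ l
             * ((deriv ^^ (n - k)) (u p) x / x ^ (k + l)))"
    proof (intro sum.cong refl)
      fix k assume "k \<in> {1..n}"
      then have "exp (c / x) * (real (n choose k) * (deriv ^^ k) ?Er x * (deriv ^^ (n - k)) (u p) x)
          = (\<Sum>l=1..k. of_int (exp_inv_coeff (l + k) k) * c ^ l / x ^ (k + l))
            * (real (n choose k) * (deriv ^^ (n - k)) (u p) x)"
        by (subst dEr[symmetric]) (auto simp: mult_ac)
      also have "\<dots> = (\<Sum>l=1..k. real (n choose k) * of_int (exp_inv_coeff (l + k) k) * c ^ l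
             * ((deriv ^^ (n - k)) (u p) x / x ^ (k + l)))"
        unfolding sum_distrib_right by (intro sum.cong refl) (simp add: mult_ac)
      finally show "exp (c / x) * (real (n choose k) * (deriv ^^ k) ?Er x * (deriv ^^ (n - k)) (u p) x) = \<dots>" .
    qed
    finally show ?thesis by (simp add: c_def)
  qed
  show ?thesis
    unfolding eventually_at_right_field by (rule exI[of _ r]) (use r eq in auto)
qed

text \<open>
  The derivative of \<open>u p\<close> of order \<open>n - k\<close> is divided by at most \<open>x ^ (2 * k)\<close>. Its Taylor polynomial
  of degree \<open>2 * k\<close> has an error of order \<open>x ^ (2 * k + 1)\<close>, which therefore leaves \<open>O(x)\<close>.
\<close>
lemma gamma_quantile_expansion_taylor:
  assumes "0 < p" "p < 1"
  shows "(\<lambda>x. exp (- ln p / x) * (deriv ^^ n) (gamma_quantile p) x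
            - (u_deriv0 p n
               + (\<Sum>k=1..n. \<Sum>l=1..k. \<Sum>j=0..2*k.
                    real (n choose k) * of_int (exp_inv_coeff (l + k) k) * (- ln p) ^ l
                    * (u_deriv0 p (n - k + j) / (fact j * x powi (int k + int l - int j))))))
         \<in> O[at_right 0](\<lambda>x. x)"
proof -
  let ?a = "\<lambda>k l. real (n choose k) * of_int (exp_inv_coeff (l + k) k) * (- ln p) ^ l"
  let ?R = "\<lambda>k x. (deriv ^^ (n - k)) (u p) x - (\<Sum>j=0..2*k. u_deriv0 p (n - k + j) / fact j * x ^ j)"
  have pos: "\<forall>\<^sub>F x in at_right 0. (0 :: real) < x"
    unfolding eventually_at_right_field by (intro exI[of _ 1]) auto
  have lead: "(\<lambda>x. (deriv ^^ n) (u p) x - u_deriv0 p n) \<in> O[at_right 0](\<lambda>x. x)"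
    using higher_deriv_u_expansion[OF assms, of n 0] by simp
  have rest: "(\<lambda>x. ?a k l * (?R k x / x ^ (k + l))) \<in> O[at_right 0](\<lambda>x. x)" if "l \<le> k" for k l
  proof -
    have "(\<lambda>x. ?R k x / x ^ (k + l)) \<in> O[at_right 0](\<lambda>x. x ^ Suc (2 * k) / x ^ (k + l))"
      by (rule landau_o.big.divide_right[OF _ higher_deriv_u_expansion[OF assms]])
         (rule eventually_mono[OF pos], simp)
    also have "(\<lambda>x::real. x ^ Suc (2 * k) / x ^ (k + l)) \<in> O[at_right 0](\<lambda>x. x)"
    proof (rule bigoI[where c = 1])
      have "\<forall>\<^sub>F x in at_right 0. 0 < x \<and> x < (1 :: real)"
        unfolding eventually_at_right_field by (intro exI[of _ 1]) auto
      then show "\<forall>\<^sub>F x::real in at_right 0. norm (x ^ Suc (2 * k) / x ^ (k + l)) \<le> 1 * norm x"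
      proof eventually_elim
        case (elim x)
        have "Suc (2 * k) = (k + l) + Suc (k - l)" using that by simp
        then have "x ^ Suc (2 * k) / x ^ (k + l) = x ^ Suc (k - l)"
          using elim by (simp only: power_add) simp
        then show ?case
          using elim power_decreasing[of 1 "Suc (k - l)" x] by simp
      qed
    qed
    finally have "(\<lambda>x. ?R k x / x ^ (k + l)) \<in> O[at_right 0](\<lambda>x. x)" .
    moreover have "(\<lambda>x. ?a k l * (?R k x / x ^ (k + l))) \<in> O[at_right 0](\<lambda>x. ?R k x / x ^ (k + l))"
      by (rule bigoI[where c = "\<bar>?a k l\<bar>"]) (simp only: real_norm_def abs_mult order_refl eventually_True)
    ultimately show ?thesis
      by (rule landau_o.big_trans[rotated])
  qed
  have remainder: "(\<lambda>x. ((deriv ^^ n) (u p) x - u_deriv0 p n)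
      + (\<Sum>k=1..n. \<Sum>l=1..k. ?a k l * (?R k x / x ^ (k + l)))) \<in> O[at_right 0](\<lambda>x. x)"
  proof (rule sum_in_bigo(1)[OF lead])
    show "(\<lambda>x. \<Sum>k=1..n. \<Sum>l=1..k. ?a k l * (?R k x / x ^ (k + l))) \<in> O[at_right 0](\<lambda>x. x)"
    proof (intro big_sum_in_bigo)
      fix k l :: nat assume "l \<in> {1..k}"
      then show "(\<lambda>x. ?a k l * (?R k x / x ^ (k + l))) \<in> O[at_right 0](\<lambda>x. x)"
        by (intro rest) simp
    qed
  qed
  have ev: "\<forall>\<^sub>F x in at_right 0.
      exp (- ln p / x) * (deriv ^^ n) (gamma_quantile p) x
            - (u_deriv0 p n
               + (\<Sum>k=1..n. \<Sum>l=1..k. \<Sum>j=0..2*k.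
                    ?a k l * (u_deriv0 p (n - k + j) / (fact j * x powi (int k + int l - int j)))))
      = ((deriv ^^ n) (u p) x - u_deriv0 p n) + (\<Sum>k=1..n. \<Sum>l=1..k. ?a k l * (?R k x / x ^ (k + l)))"
    using higher_deriv_gamma_quantile[OF assms, of n] pos
  proof eventually_elim
    case (elim x)
    have "x powi (int k + int l - int j) = x ^ (k + l) / x ^ j" for k l j
      using elim(2) by (simp add: power_int_diff power_int_add power_add)
    then have "(\<Sum>j=0..2*k. ?a k l * (u_deriv0 p (n - k + j) / (fact j * x powi (int k + int l - int j))))
        = ?a k l * ((\<Sum>j=0..2*k. u_deriv0 p (n - k + j) / fact j * x ^ j) / x ^ (k + l))" for k l
      by (simp add: sum_distrib_left sum_divide_distrib)
    then show ?case
      unfolding elim(1)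
      by (simp only: diff_divide_distrib right_diff_distrib sum_subtractf add_diff_add)
  qed
  show ?thesis
    by (rule iffD2[OF landau_o.big.in_cong[OF ev] remainder])
qed

theorem corollary3p3:
  fixes p :: real and n :: nat
  assumes "0 < p" and "p < 1"
  shows "(\<lambda>x. exp (- ln p / x) * (deriv ^^ n) (gamma_quantile p) x
            - (u_deriv0 p n
               + (\<Sum>k=1..n. \<Sum>l=1..k. \<Sum>j=0..2*k.
                    real (n choose k) * of_int (exp_inv_coeff (l + k) k) * (- ln p) ^ l
                    * (u_deriv0 p (n - k + j) / (fact j * x powi (int k + int l - int j))))))
         \<in> O[at_right 0](\<lambda>x. x)
       \<and> (\<exists>z :: nat \<Rightarrow> real.
            (\<lambda>x. exp (- ln p / x) * (deriv ^^ n) (gamma_quantile p) x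
               - (\<Sum>k=0..2*n. z k / x ^ k))
            \<in> O[at_right 0](\<lambda>x. x)
          \<and> z (2 * n) = exp (- euler_mascheroni) * (- ln p) ^ n
          \<and> (n \<ge> 1 \<longrightarrow>
               z (2 * n - 1) = exp (- euler_mascheroni) * (- ln p) ^ (n - 1)
                               * (- s1 * ln p - real n * (real n - 1))))"
proof (intro conjI exI)
  let ?a = "\<lambda>k l. real (n choose k) * of_int (exp_inv_coeff (l + k) k) * (- ln p) ^ l"
  define b where "b = (\<lambda>k l j. ?a k l * (u_deriv0 p (n - k + j) / fact j))"
  \<comment> \<open>Collect the terms with the same power of \<open>x\<close>; those with \<open>j > k + l\<close> tend to 0 and join the error.\<close>
  define z where "z = (\<lambda>i. (if i = 0 then u_deriv0 p n else 0)
      + (\<Sum>k=1..n. \<Sum>l=1..k. \<Sum>j=0..2*k. if k + l = j + i then b k l j else 0))"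
  let ?G = "\<lambda>x. u_deriv0 p n
               + (\<Sum>k=1..n. \<Sum>l=1..k. \<Sum>j=0..2*k.
                    ?a k l * (u_deriv0 p (n - k + j) / (fact j * x powi (int k + int l - int j))))"
  show taylor: "(\<lambda>x. exp (- ln p / x) * (deriv ^^ n) (gamma_quantile p) x - ?G x) \<in> O[at_right 0](\<lambda>x. x)"
    by (rule gamma_quantile_expansion_taylor[OF assms])

  have surplus: "(\<lambda>x. \<Sum>k=1..n. \<Sum>l=1..k. \<Sum>j=0..2*k. if j \<le> k + l then 0 else b k l j * x ^ (j - (k + l)))
      \<in> O[at_right 0](\<lambda>x. x)"
  proof (intro big_sum_in_bigo)
    fix k l j :: nat
    show "(\<lambda>x. if j \<le> k + l then 0 else b k l j * x ^ (j - (k + l))) \<in> O[at_right 0](\<lambda>x. x)"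
    proof (cases "j \<le> k + l")
      case False
      have "(\<lambda>x::real. x ^ (j - (k + l))) \<in> O[at_right 0](\<lambda>x. x)"
      proof (rule bigoI[where c = 1])
        have "\<forall>\<^sub>F x in at_right 0. 0 < x \<and> x < (1 :: real)"
          unfolding eventually_at_right_field by (intro exI[of _ 1]) auto
        then show "\<forall>\<^sub>F x::real in at_right 0. norm (x ^ (j - (k + l))) \<le> 1 * norm x"
        proof eventually_elim
          case (elim x)
          then show ?case using False power_decreasing[of 1 "j - (k + l)" x] by simp
        qed
      qed
      then show ?thesis using False by simp
    qed simp
  qed
  have ev: "\<forall>\<^sub>F x in at_right 0. ?G x - (\<Sum>i=0..2*n. z i / x ^ i)
      = (\<Sum>k=1..n. \<Sum>l=1..k. \<Sum>j=0..2*k. if j \<le> k + l then 0 else b k l j * x ^ (j - (k + l)))"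
  proof -
    have "?G x - (\<Sum>i=0..2*n. z i / x ^ i)
      = (\<Sum>k=1..n. \<Sum>l=1..k. \<Sum>j=0..2*k. if j \<le> k + l then 0 else b k l j * x ^ (j - (k + l)))"
      if x: "x > 0" for x
    proof -
      have "(\<Sum>i=0..2*n. z i / x ^ i)
          = (\<Sum>i=0..2*n. if i = 0 then u_deriv0 p n else 0)
            + (\<Sum>i=0..2*n. \<Sum>k=1..n. \<Sum>l=1..k. \<Sum>j=0..2*k. if k + l = j + i then b k l j / x ^ i else 0)"
        unfolding z_def sum.distrib[symmetric]
        by (intro sum.cong refl) (simp add: add_divide_distrib sum_divide_distrib if_distrib[of "\<lambda>t. t / _"] cong: if_cong)
      also have "(\<Sum>i=0..2*n. if i = 0 then u_deriv0 p n else 0) = u_deriv0 p n"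
        by simp
      also have "(\<Sum>i=0..2*n. \<Sum>k=1..n. \<Sum>l=1..k. \<Sum>j=0..2*k. if k + l = j + i then b k l j / x ^ i else 0)
          = (\<Sum>k=1..n. \<Sum>l=1..k. \<Sum>j=0..2*k. \<Sum>i=0..2*n. if k + l = j + i then b k l j / x ^ i else 0)"
        by (simp only: sum.swap[of _ _ "{0..2*n}"])
      also have "\<dots> = (\<Sum>k=1..n. \<Sum>l=1..k. \<Sum>j=0..2*k. if j \<le> k + l then b k l j / x ^ (k + l - j) else 0)"
      proof (intro sum.cong refl)
        fix k l j assume kl: "k \<in> {1..n}" "l \<in> {1..k}"
        show "(\<Sum>i=0..2*n. if k + l = j + i then b k l j / x ^ i else 0)
            = (if j \<le> k + l then b k l j / x ^ (k + l - j) else 0)"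
        proof (cases "j \<le> k + l")
          case True
          then have "(k + l = j + i) = (i = k + l - j)" for i by auto
          moreover have "k + l - j \<le> 2 * n" using kl by auto
          ultimately show ?thesis using True by simp
        next
          case False
          then show ?thesis by (auto intro: sum.neutral)
        qed
      qed
      finally have *: "(\<Sum>i=0..2*n. z i / x ^ i) = u_deriv0 p n
          + (\<Sum>k=1..n. \<Sum>l=1..k. \<Sum>j=0..2*k. if j \<le> k + l then b k l j / x ^ (k + l - j) else 0)" .
      have split: "?a k l * (u_deriv0 p (n - k + j) / (fact j * x powi (int k + int l - int j)))
          = (if j \<le> k + l then b k l j / x ^ (k + l - j) else 0)
            + (if j \<le> k + l then 0 else b k l j * x ^ (j - (k + l)))" for k l j
      proof (cases "j \<le> k + l")
        case True
        then have "int k + int l - int j = int (k + l - j)" by simp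
        then show ?thesis using True by (simp only: power_int_of_nat) (simp add: b_def)
      next
        case False
        then have "int k + int l - int j = - int (j - (k + l))" by simp
        then show ?thesis
          using False by (simp only: power_int_minus power_int_of_nat) (simp add: b_def divide_inverse)
      qed
      show ?thesis
        unfolding * split sum.distrib by (simp only: add_diff_cancel_left add_diff_cancel_left')
    qed
    then show ?thesis
      unfolding eventually_at_right_field by (intro exI[of _ 1]) auto
  qed
  have "(\<lambda>x. ?G x - (\<Sum>i=0..2*n. z i / x ^ i)) \<in> O[at_right 0](\<lambda>x. x)"
    by (rule iffD2[OF landau_o.big.in_cong[OF ev] surplus])
  from sum_in_bigo(1)[OF taylor this]
  show "(\<lambda>x. exp (- ln p / x) * (deriv ^^ n) (gamma_quantile p) x - (\<Sum>i=0..2*n. z i / x ^ i))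
      \<in> O[at_right 0](\<lambda>x. x)"
    by simp

  \<comment> \<open>The exponent \<open>k + l - j\<close> is at most \<open>2 * k\<close>, so it reaches \<open>2 * n - 1\<close> only for \<open>k = n\<close>.\<close>
  have only_top: "(\<Sum>k=1..n. \<Sum>l=1..k. \<Sum>j=0..2*k. if k + l = j + i then b k l j else 0)
      = (\<Sum>l=1..n. \<Sum>j=0..2*n. if n + l = j + i then b n l j else 0)"
    if "n \<ge> 1" "i \<ge> 2 * n - 1" for i
  proof -
    have "(\<Sum>l=1..k. \<Sum>j=0..2*k. if k + l = j + i then b k l j else 0) = 0"
      if "k \<in> {1..n} - {n}" for k
      using that \<open>i \<ge> 2 * n - 1\<close> by (intro sum.neutral ballI) auto
    then show ?thesis
      using \<open>n \<ge> 1\<close> by (subst sum.remove[of _ n]) (auto intro: sum.neutral)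
  qed
  have inner: "(\<Sum>j=0..2*n. if n + l = j + i then b n l j else 0)
      = (if i \<le> n + l then b n l (n + l - i) else 0)" if "l \<le> n" for i l
  proof (cases "i \<le> n + l")
    case True
    then have "(n + l = j + i) = (j = n + l - i)" for j by auto
    then show ?thesis using True that by simp
  next
    case False
    then show ?thesis by (auto intro: sum.neutral)
  qed
  have z_top: "z i = (\<Sum>l=1..n. if i \<le> n + l then b n l (n + l - i) else 0)"
    if "n \<ge> 1" "i \<ge> 2 * n - 1" for i
  proof -
    have "i \<noteq> 0" using that by simp
    then have "z i = (\<Sum>l=1..n. \<Sum>j=0..2*n. if n + l = j + i then b n l j else 0)"
      unfolding z_def only_top[OF that] by simp
    also have "\<dots> = (\<Sum>l=1..n. if i \<le> n + l then b n l (n + l - i) else 0)"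
      by (intro sum.cong refl inner) simp
    finally show ?thesis .
  qed
  have top: "of_int (exp_inv_coeff (n + n) n) = (1 :: real)"
    "of_int (exp_inv_coeff (n - 1 + n) n) = - (real n * (real n - 1))" if "n \<ge> 1"
    using of_int_exp_inv_coeff[OF that] coeff_exp_inv_poly_top[of n] coeff_exp_inv_poly_below_top[OF that] that
    by (simp_all add: mult_2)
  show "z (2 * n) = exp (- euler_mascheroni) * (- ln p) ^ n"
  proof (cases "n \<ge> 1")
    case False
    then have "n = 0" by simp
    then show ?thesis using u_deriv0_0[OF assms] by (simp add: z_def)
  next
    case True
    have "z (2 * n) = (\<Sum>l=1..n. if 2 * n \<le> n + l then b n l (n + l - 2 * n) else 0)"
      by (rule z_top[OF True]) simp
    also have "\<dots> = (\<Sum>l=1..n. if l = n then b n n 0 else 0)"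
      by (intro sum.cong) auto
    also have "\<dots> = b n n 0" using True by simp
    also have "\<dots> = exp (- euler_mascheroni) * (- ln p) ^ n"
      using top[OF True] u_deriv0_0[OF assms] by (simp add: b_def)
    finally show ?thesis .
  qed
  show "n \<ge> 1 \<longrightarrow> z (2 * n - 1) = exp (- euler_mascheroni) * (- ln p) ^ (n - 1)
                               * (- s1 * ln p - real n * (real n - 1))"
  proof
    assume n: "n \<ge> 1"
    have b1: "b n n 1 = exp (- euler_mascheroni) * s1 * (- ln p) ^ n"
      using top[OF n] u_deriv0_1[OF assms] by (simp add: b_def s1_eq)
    have b0: "b n (n - 1) 0 = - exp (- euler_mascheroni) * (real n * (real n - 1)) * (- ln p) ^ (n - 1)"
      using top[OF n] u_deriv0_0[OF assms] by (simp add: b_def)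
    have "z (2 * n - 1) = (\<Sum>l=1..n. if 2 * n - 1 \<le> n + l then b n l (n + l - (2 * n - 1)) else 0)"
      by (rule z_top[OF n]) simp
    also have "\<dots> = (\<Sum>l=1..n. (if l = n then b n n 1 else 0) + (if l = n - 1 then b n (n - 1) 0 else 0))"
      using n by (intro sum.cong) auto
    also have "\<dots> = b n n 1 + (if n = 1 then 0 else b n (n - 1) 0)"
      using n by (auto simp: sum.distrib)
    \<comment> \<open>For \<open>n = 1\<close> the index \<open>l = n - 1\<close> is outside the sum, but its coefficient \<open>- n * (n - 1)\<close> vanishes.\<close>
    also have "\<dots> = b n n 1 + b n (n - 1) 0"
      unfolding b0 by simp
    also have "\<dots> = exp (- euler_mascheroni) * (- ln p) ^ (n - 1) * (- s1 * ln p - real n * (real n - 1))"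
    proof -
      have "(- ln p) ^ n = (- ln p) ^ (n - 1) * (- ln p)"
        using n by (cases n) auto
      then show ?thesis unfolding b0 b1 by (simp only: algebra_simps)
    qed
    finally show "z (2 * n - 1) = exp (- euler_mascheroni) * (- ln p) ^ (n - 1)
                               * (- s1 * ln p - real n * (real n - 1))" .
  qed
qed

end
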